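(* For every $\mathcal{A}\in\mathfrak{A}$ and every $\gamma\in\mathfrak{G}_1$, $$\langle\!\langle d\mathcal{A},\gamma\rangle\!\rangle=\langle\!\langle \mathcal{A},\partial\gamma\rangle\!\rangle .$$
   Context: A (based) arrow diagram of degree $n$ is an oriented real line with $n$ abstract oriented chords ("arrows"), each having a tail and a head, attached at $2n$ distinct points. Diagrams are considered up to orientation-preserving homeomorphisms of the line. A (based) Gauss diagram is an arrow diagram in which each arrow carries a sign $\pm1$. $\mathfrak{G}$ denotes the $\mathbb{Q}$-vector space with basis the Gauss diagrams, and $\mathfrak{A}$ the $\mathbb{Q}$-vector space with basis the arrow diagrams. $\langle\,,\rangle$ denotes the scalar product for which the relevant basis (Gauss diagrams, resp. germs below) is orthonormal. Edges and signs. The complement of the arrow endpoints in the line consists of segments called edges. For an edge $e$ bounded by endpoints of two different arrows, set $\eta(e)=+1$ if these two arrows cross each other (their endpoints interlace along the line) and $-1$ otherwise. Let $\uparrow(e)$ be the number of arrowheads among the two boundary endpoints of $e$. Put $\varepsilon(e)=\eta(e)(-1)^{\uparrow(e)}$, and let $\mathrm{w}(e)$ be the product of the signs of the two arrows bounding $e$. R-moves on Gauss diagrams. - R$_1$: birth or death of an arrow, with any sign and direction, whose two endpoints are adjacent (no other endpoint lies between them). - R$_2$: birth or death of two arrows of opposite signs whose heads are adjacent and whose tails are adjacent. - R$_3$: consider three arrows $a,b,c$ and three edges $e_1,e_2,e_3$ such that each edge is bounded by endpoints of two of these arrows and each pair of the arrows bounds exactly one of these edges. The move simultaneously swaps the two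 endpoints bounding each $e_i$. It is allowed when both of the following hold: (1) $\mathrm{w}(e_i)\varepsilon(e_i)$ is the same for $i=1,2,3$; (2) the numbers $\uparrow(e_1),\uparrow(e_2),\uparrow(e_3)$ are pairwise distinct. Germs. For $i=1,2,3$, an $i$-germ is an ordered pair $(G_0,G_1)$ of Gauss diagrams that differ by one R$_i$-move. The edges involved in the move are recorded as "distinguished", and an arrow adjacent to a distinguished edge is called distinguished. Arrows of $G_0$ and $G_1$ not involved in the move correspond naturally to each other. - A partial 3-germ is obtained from a 3-germ by removing one of the three distinguished arrows from both diagrams. - A subgerm of a germ $(G_0,G_1)$ is obtained by removing a set of arrows from $G_0$ together with their counterparts in $G_1$. For $i=1,2$ no distinguished arrow may be removed; for $i=3$ at most one distinguished arrow may be removed. Thus a subgerm is either a germ or a partial 3-germ. - Arrow germs and partial arrow germs are defined in the same way, with unsigned arrows (they are the sign-forgettings of germs and partial germs). Spaces of germs. $\mathfrak{G}_I,\mathfrak{G}_{II},\mathfrak{G}_\Delta,\mathfrak{G}_\Lambda$ are the $\mathbb{Q}$-spaces spanned by 1-germs, 2-germs, 3-germs and partial 3-germs respectively, with relations $(x,y)+(y,x)=0$ in the R$_3$ cases. The spaces $\mathfrak{A}^I,\mathfrak{A}^{II},\mathfrak{A}^\Delta,\mathfrak{A}^\Lambda$ are the analogous spaces of arrow germs. Set $\mathfrak{G}_1=\mathfrak{G}_I\oplus\mathfrak{G}_{II}\oplus\mathfrak{G}_\Delta$. Maps. - $\partial:\mathfrak{G}_1\to\mathfrak{G}$ is given by $\partial(G_0,G_1)=G_1-G_0$.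 - For an arrow diagram or arrow germ $\alpha$ with $n$ arrows, $S(\alpha)=\sum_{\sigma\in\{\pm1\}^n}\mathrm{sign}(\sigma)\,\alpha^\sigma$. Here $\alpha^\sigma$ is the signed version of $\alpha$ (signs assigned consistently to corresponding arrows of both diagrams of a germ), $\mathrm{sign}(\sigma)$ is the product of the signs, and only those $\alpha^\sigma$ that are genuine Gauss diagrams, germs or partial germs contribute. - $I(G)$ is the formal sum of all $2^{\deg G}$ subdiagrams of a Gauss diagram $G$, and $I:\mathfrak{G}_1\to\mathfrak{G}_1\oplus\mathfrak{G}_\Lambda$ sends a germ to the formal sum of its subgerms. Pairings. For $A\in\mathfrak{A}$ and $G\in\mathfrak{G}$, set $\langle\!\langle A,G\rangle\!\rangle=\langle S(A),I(G)\rangle$. For $\alpha\in\mathfrak{A}^I\oplus\mathfrak{A}^{II}\oplus\mathfrak{A}^\Delta\oplus\mathfrak{A}^\Lambda$ and $\gamma\in\mathfrak{G}_1$, set $\langle\!\langle \alpha,\gamma\rangle\!\rangle=\langle S(\alpha),I(\gamma)\rangle$. Both are extended bilinearly. Coboundary. For an arrow diagram $A$, $dA$ is the formal sum of all arrow 1-, 2-, 3-germs and partial arrow 3-germs $(A^0,A^1)$ such that $A^1$, after forgetting which edges are distinguished, equals $A$, and such that $A^1$ has at least as many arrows as $A^0$. $d$ is extended linearly to $\mathfrak{A}$.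
   Formalization: 1- and 2-germs are taken as births only (G_1 has more arrows): for death germs, left independent by the relations, the identity fails (single isolated arrow to empty). In R_3 the three edges must have six distinct endpoints, else the simultaneous swap is undefined. *)

theory Defs
  imports Complex_Main "HOL-Library.FuncSet"
begin

text \<open>A diagram with n arrows is encoded canonically (no labels, no quotient needed):
  its 2n endpoints sit at the positions 0,...,2n-1 of the line (in order), and an
  arrow is a triple (tail position, head position, label).  For Gauss diagrams the
  label is the sign (True = +1, False = -1); for arrow diagrams the label is unit.\<close>

type_synonym 's arr = "nat \<times> nat \<times> 's"
type_synonym gauss = "bool arr set"
type_synonym arrowd = "unit arr set"

definition atl :: "'s arr \<Rightarrow> nat" where "atl x = fst x"
definition ahd :: "'s arr \<Rightarrow> nat" where "ahd x = fst (snd x)"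
definition alab :: "'s arr \<Rightarrow> 's" where "alab x = snd (snd x)"
definition ends :: "'s arr \<Rightarrow> nat set" where "ends x = {atl x, ahd x}"
definition allends :: "'s arr set \<Rightarrow> nat set" where "allends G = (\<Union>x\<in>G. ends x)"

definition wf_diag :: "'s arr set \<Rightarrow> bool" where
  "wf_diag G \<longleftrightarrow> finite G \<and> (\<forall>x\<in>G. atl x \<noteq> ahd x)
     \<and> (\<forall>x\<in>G. \<forall>y\<in>G. x \<noteq> y \<longrightarrow> ends x \<inter> ends y = {})
     \<and> allends G = {..<2 * card G}"

definition rank :: "nat set \<Rightarrow> nat \<Rightarrow> nat" where "rank P p = card {q\<in>P. q < p}"

definition cmap :: "'s arr set \<Rightarrow> 's arr set \<Rightarrow> 's arr \<Rightarrow> 's arr" where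
  "cmap G X x = (rank (allends (G - X)) (atl x), rank (allends (G - X)) (ahd x), alab x)"

definition rem :: "'s arr set \<Rightarrow> 's arr set \<Rightarrow> 's arr set" where
  "rem G X = cmap G X ` (G - X)"

definition amap :: "(nat \<Rightarrow> nat) \<Rightarrow> 's arr \<Rightarrow> 's arr" where
  "amap f x = (f (atl x), f (ahd x), alab x)"

definition setlab :: "'s arr \<Rightarrow> 't \<Rightarrow> 't arr" where
  "setlab x l = (atl x, ahd x, l)"

text \<open>Edge (gap) number j is the segment between positions j-1 and j (1 \<le> j < 2n);
  the two unbounded rays are never bounded by two arrows.\<close>

definition arr_at :: "'s arr set \<Rightarrow> nat \<Rightarrow> 's arr" where
  "arr_at G p = (THE x. x \<in> G \<and> p \<in> ends x)"

definition two_arrow_edge :: "'s arr set \<Rightarrow> nat \<Rightarrow> bool" where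
  "two_arrow_edge G j \<longleftrightarrow> 1 \<le> j \<and> j < 2 * card G \<and> arr_at G (j - 1) \<noteq> arr_at G j"

definition edge_arrows :: "'s arr set \<Rightarrow> nat \<Rightarrow> 's arr set" where
  "edge_arrows G j = {arr_at G (j - 1), arr_at G j}"

definition between :: "'s arr \<Rightarrow> nat \<Rightarrow> bool" where
  "between x p \<longleftrightarrow> min (atl x) (ahd x) < p \<and> p < max (atl x) (ahd x)"

definition crosses :: "'s arr \<Rightarrow> 's arr \<Rightarrow> bool" where
  "crosses x y \<longleftrightarrow> (between x (atl y) \<noteq> between x (ahd y))"

definition eta :: "'s arr set \<Rightarrow> nat \<Rightarrow> int" where
  "eta G j = (if crosses (arr_at G (j - 1)) (arr_at G j) then 1 else -1)"

definition ups :: "'s arr set \<Rightarrow> nat \<Rightarrow> nat" where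
  "ups G j = (if ahd (arr_at G (j - 1)) = j - 1 then 1 else 0)
           + (if ahd (arr_at G j) = j then 1 else 0)"

definition eps :: "'s arr set \<Rightarrow> nat \<Rightarrow> int" where
  "eps G j = eta G j * (-1) ^ ups G j"

definition sgnv :: "bool arr \<Rightarrow> int" where
  "sgnv x = (if alab x then 1 else -1)"

definition wsgn :: "gauss \<Rightarrow> nat \<Rightarrow> int" where
  "wsgn G j = sgnv (arr_at G (j - 1)) * sgnv (arr_at G j)"

text \<open>A (Gauss or arrow) germ is a quadruple (k, G0, G1, E): k is its type
  (1 = R1, 2 = R2, 3 = R3, 4 = partial R3), (G0, G1) the ordered pair of diagrams,
  and E the set of distinguished edges, given as edge numbers of G1
  (for R3 and partial R3 germs the edges have the same numbers in G0 and G1).\<close>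

type_synonym 's germ = "nat \<times> 's arr set \<times> 's arr set \<times> nat set"

definition gkind :: "'s germ \<Rightarrow> nat" where "gkind g = fst g"
definition gG0 :: "'s germ \<Rightarrow> 's arr set" where "gG0 g = fst (snd g)"
definition gG1 :: "'s germ \<Rightarrow> 's arr set" where "gG1 g = fst (snd (snd g))"
definition gE :: "'s germ \<Rightarrow> nat set" where "gE g = snd (snd (snd g))"

definition flip :: "'s germ \<Rightarrow> 's germ" where
  "flip g = (gkind g, gG1 g, gG0 g, gE g)"

definition dist :: "'s arr set \<Rightarrow> nat set \<Rightarrow> 's arr set" where
  "dist G E = {x\<in>G. \<exists>j\<in>E. j - 1 \<in> ends x \<or> j \<in> ends x}"

definition swapE :: "nat set \<Rightarrow> nat \<Rightarrow> nat" where
  "swapE E p = (if p \<in> E then p - 1 else if Suc p \<in> E then Suc p else p)"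

definition r1_germ :: "bool germ \<Rightarrow> bool" where
  "r1_germ g \<longleftrightarrow> gkind g = 1 \<and> wf_diag (gG1 g) \<and>
     (\<exists>a\<in>gG1 g. (ahd a = Suc (atl a) \<or> atl a = Suc (ahd a))
        \<and> gE g = {max (atl a) (ahd a)} \<and> gG0 g = rem (gG1 g) {a})"

definition r2_germ :: "bool germ \<Rightarrow> bool" where
  "r2_germ g \<longleftrightarrow> gkind g = 2 \<and> wf_diag (gG1 g) \<and>
     (\<exists>a\<in>gG1 g. \<exists>b\<in>gG1 g. a \<noteq> b \<and> alab a \<noteq> alab b
        \<and> (ahd a = Suc (ahd b) \<or> ahd b = Suc (ahd a))
        \<and> (atl a = Suc (atl b) \<or> atl b = Suc (atl a))
        \<and> gE g = {max (ahd a) (ahd b), max (atl a) (atl b)}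
        \<and> gG0 g = rem (gG1 g) {a, b})"

definition r3_germ :: "bool germ \<Rightarrow> bool" where
  "r3_germ g \<longleftrightarrow> gkind g = 3 \<and> wf_diag (gG0 g) \<and>
        card (gE g) = 3 \<and> (\<forall>j\<in>gE g. two_arrow_edge (gG0 g) j)
        \<and> card (\<Union>j\<in>gE g. {j - 1, j}) = 6
        \<and> card (\<Union>j\<in>gE g. edge_arrows (gG0 g) j) = 3 \<and> inj_on (edge_arrows (gG0 g)) (gE g)
        \<and> (\<exists>c. \<forall>j\<in>gE g. wsgn (gG0 g) j * eps (gG0 g) j = c)
        \<and> inj_on (ups (gG0 g)) (gE g)
        \<and> gG1 g = amap (swapE (gE g)) ` gG0 g"

definition is_germ :: "bool germ \<Rightarrow> bool" where
  "is_germ g \<longleftrightarrow> r1_germ g \<or> r2_germ g \<or> r3_germ g"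

text \<open>Correspondence of arrows of G1 (not involved in the move) with arrows of G0.\<close>
definition corr :: "nat \<Rightarrow> nat set \<Rightarrow> 's arr set \<Rightarrow> 's arr \<Rightarrow> 's arr" where
  "corr k E G1 x = (if k \<in> {1, 2} then cmap G1 (dist G1 E) x else amap (swapE E) x)"

definition excl :: "nat \<Rightarrow> nat set \<Rightarrow> 's arr set \<Rightarrow> 's arr set" where
  "excl k E G1 = (if k \<in> {1, 2} then dist G1 E else {})"

definition sub :: "'s germ \<Rightarrow> 's arr set \<Rightarrow> 's germ" where
  "sub g X = (let k = gkind g; G1 = gG1 g; E = gE g; P = allends (G1 - X) in
     (if k = 3 \<and> X \<inter> dist G1 E \<noteq> {} then 4 else k,
      rem (gG0 g) (corr k E G1 ` X),
      rem G1 X,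
      rank P ` {j\<in>E. j - 1 \<in> P \<and> j \<in> P}))"

definition admissible :: "'s germ \<Rightarrow> 's arr set \<Rightarrow> bool" where
  "admissible g X \<longleftrightarrow> X \<subseteq> gG1 g \<and>
     (if gkind g \<in> {1, 2} then X \<inter> dist (gG1 g) (gE g) = {}
      else card (X \<inter> dist (gG1 g) (gE g)) \<le> 1)"

definition is_pgerm :: "bool germ \<Rightarrow> bool" where
  "is_pgerm h \<longleftrightarrow> (\<exists>g c. r3_germ g \<and> c \<in> dist (gG1 g) (gE g) \<and> h = sub g {c})"

definition forget :: "gauss \<Rightarrow> arrowd" where
  "forget G = (\<lambda>x. setlab x ()) ` G"

definition forget_germ :: "bool germ \<Rightarrow> unit germ" where
  "forget_germ g = (gkind g, forget (gG0 g), forget (gG1 g), gE g)"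

definition is_agerm :: "unit germ \<Rightarrow> bool" where
  "is_agerm a \<longleftrightarrow> (\<exists>g. is_germ g \<and> forget_germ g = a)"

definition is_apgerm :: "unit germ \<Rightarrow> bool" where
  "is_apgerm a \<longleftrightarrow> (\<exists>g. is_pgerm g \<and> forget_germ g = a)"

definition sign_diag :: "arrowd \<Rightarrow> (unit arr \<Rightarrow> bool) \<Rightarrow> gauss" where
  "sign_diag A \<sigma> = (\<lambda>x. setlab x (\<sigma> x)) ` A"

definition sign_germ :: "unit germ \<Rightarrow> (unit arr \<Rightarrow> bool) \<Rightarrow> bool germ" where
  "sign_germ a \<sigma> = (gkind a,
      (\<lambda>x. setlab (corr (gkind a) (gE a) (gG1 a) x) (\<sigma> x)) ` (gG1 a - excl (gkind a) (gE a) (gG1 a)),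
      sign_diag (gG1 a) \<sigma>, gE a)"

definition sgnprod :: "'a set \<Rightarrow> ('a \<Rightarrow> bool) \<Rightarrow> rat" where
  "sgnprod A \<sigma> = (\<Prod>x\<in>A. if \<sigma> x then 1 else -1)"

section \<open>Vectors (finitely supported Q-valued functions on the basis) and maps\<close>

definition supp :: "('a \<Rightarrow> rat) \<Rightarrow> 'a set" where "supp f = {x. f x \<noteq> 0}"

definition S_diag :: "arrowd \<Rightarrow> gauss \<Rightarrow> rat" where
  "S_diag A = (\<lambda>G. \<Sum>\<sigma>\<in>PiE A (\<lambda>_. UNIV).
      if wf_diag (sign_diag A \<sigma>) \<and> sign_diag A \<sigma> = G then sgnprod A \<sigma> else 0)"

definition S_germ :: "unit germ \<Rightarrow> bool germ \<Rightarrow> rat" where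
  "S_germ a = (\<lambda>h. \<Sum>\<sigma>\<in>PiE (gG1 a) (\<lambda>_. UNIV).
      if (is_germ (sign_germ a \<sigma>) \<or> is_pgerm (sign_germ a \<sigma>))
         \<and> forget_germ (sign_germ a \<sigma>) = a \<and> sign_germ a \<sigma> = h
      then sgnprod (gG1 a) \<sigma> else 0)"

definition I_diag :: "gauss \<Rightarrow> gauss \<Rightarrow> rat" where
  "I_diag G = (\<lambda>H. of_nat (card {X. X \<subseteq> G \<and> rem G X = H}))"

definition I_germ :: "bool germ \<Rightarrow> bool germ \<Rightarrow> rat" where
  "I_germ g = (\<lambda>h. of_nat (card {X. admissible g X \<and> sub g X = h}))"

definition bd :: "(bool germ \<Rightarrow> rat) \<Rightarrow> gauss \<Rightarrow> rat" where
  "bd \<gamma> = (\<lambda>G. \<Sum>g\<in>supp \<gamma>. \<gamma> g * ((if gG1 g = G then 1 else 0) - (if gG0 g = G then 1 else 0)))"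

definition d_basis :: "arrowd \<Rightarrow> unit germ \<Rightarrow> rat" where
  "d_basis A = (\<lambda>a. if (is_agerm a \<or> is_apgerm a) \<and> gG1 a = A \<and> card (gG0 a) \<le> card (gG1 a)
                   then 1 else 0)"

definition d_lin :: "(arrowd \<Rightarrow> rat) \<Rightarrow> unit germ \<Rightarrow> rat" where
  "d_lin \<A> = (\<lambda>a. \<Sum>A\<in>supp \<A>. \<A> A * d_basis A a)"

definition ip_diag :: "(gauss \<Rightarrow> rat) \<Rightarrow> (gauss \<Rightarrow> rat) \<Rightarrow> rat" where
  "ip_diag u v = (\<Sum>G\<in>supp u \<inter> supp v. u G * v G)"

text \<open>Scalar product on G_I + G_II + G_Delta + G_Lambda.  On the R3 and partial R3 parts the
  relation (x,y) + (y,x) = 0 is imposed; the orthonormal basis there consists of one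
  representative of each pair {g, flip g}, which gives the antisymmetrised formula below.\<close>
definition ip_germ :: "(bool germ \<Rightarrow> rat) \<Rightarrow> (bool germ \<Rightarrow> rat) \<Rightarrow> rat" where
  "ip_germ u v =
     (\<Sum>g\<in>{g\<in>supp u \<inter> supp v. gkind g \<in> {1, 2}}. u g * v g)
   + (1/2) * (\<Sum>g\<in>{g. gkind g \<in> {3, 4} \<and> (u g \<noteq> 0 \<or> v g \<noteq> 0 \<or> u (flip g) \<noteq> 0 \<or> v (flip g) \<noteq> 0)}.
                 (u g - u (flip g)) * (v g - v (flip g)))"

definition pairD :: "(arrowd \<Rightarrow> rat) \<Rightarrow> (gauss \<Rightarrow> rat) \<Rightarrow> rat" where
  "pairD \<A> \<Gamma> = (\<Sum>A\<in>supp \<A>. \<Sum>G\<in>supp \<Gamma>. \<A> A * \<Gamma> G * ip_diag (S_diag A) (I_diag G))"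

definition pairG :: "(unit germ \<Rightarrow> rat) \<Rightarrow> (bool germ \<Rightarrow> rat) \<Rightarrow> rat" where
  "pairG \<alpha> \<gamma> = (\<Sum>a\<in>supp \<alpha>. \<Sum>g\<in>supp \<gamma>. \<alpha> a * \<gamma> g * ip_germ (S_germ a) (I_germ g))"

end

theory Submission
  imports Defs
begin

text \<open>Fix an arrow diagram \<open>A\<close> and a germ \<open>g = (G\<^sub>0, G\<^sub>1)\<close>. Both pairings are sums, over the
  subdiagrams obtained from \<open>G\<^sub>0\<close> or \<open>G\<^sub>1\<close> that equal \<open>A\<close> after forgetting signs, of products of
  signs. The subdiagrams that come from a subgerm account for \<open>dA\<close>; the others cancel. For R1 and R2,
  those of \<open>G\<^sub>1\<close> avoiding all distinguished arrows are the subdiagrams of \<open>G\<^sub>0\<close>, and those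
  containing exactly one of the two R2 arrows cancel in pairs since the arrows have opposite signs.
  For R3, once two of the three distinguished arrows are removed, every distinguished edge has lost an
  end, so that the swap of the ends is order preserving on what remains and the two diagrams agree.
  All identifications of diagrams rest on one fact: relabelling the end positions by a map that is
  strictly increasing on them does not change the normalised diagram.\<close>

section \<open>Relabelling and normalising diagrams\<close>

text \<open>Positions form an initial segment of the naturals, so every removal renumbers the
  remaining ends and edges. Each identity of subdiagrams thus says that renumbering commutes with
  another removal or with the R3 swap. Only germs with G1 equal to \<open>A\<close> enter dA, so for
  a 3-germ the G0 side has to come from the relation (x,y) + (y,x) = 0: a subgerm \<open>h\<close>
  counts as \<open>h\<close> minus \<open>flip h\<close>, and G0 is the second diagram of
  \<open>flip h\<close>. Hence subgerms must be compatible with \<open>flip\<close>, although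
  \<open>sub\<close> reads everything off G1. S keeps only signings that give germs or partial
  germs, so every subgerm occurring in I has to be recognised as one. For R3 the delicate point is
  the sign condition: all three pairs of arrows change between crossing and not crossing, so the
  common value changes sign but remains common. Finally, G0 can be recovered from the kind, G1 and
  the distinguished edges. Signing an arrow germ therefore amounts to signing its G1, and dA is a
  finite sum.\<close>

lemma amap_sel [simp]: "atl (amap f x) = f (atl x)" "ahd (amap f x) = f (ahd x)" "alab (amap f x) = alab x"
  by (auto simp: atl_def ahd_def alab_def amap_def)

lemma setlab_sel [simp]: "atl (setlab x l) = atl x" "ahd (setlab x l) = ahd x" "alab (setlab x l) = l"
  by (auto simp: atl_def ahd_def alab_def setlab_def)

lemma arr_eqI: "atl x = atl y \<Longrightarrow> ahd x = ahd y \<Longrightarrow> alab x = alab y \<Longrightarrow> x = y"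
  by (cases x; cases y) (auto simp: atl_def ahd_def alab_def)

lemma arr_eq_iff: "x = y \<longleftrightarrow> atl x = atl y \<and> ahd x = ahd y \<and> alab x = alab y"
  by (auto intro: arr_eqI)

lemma setlab_simps [simp]:
  "setlab (setlab x l) m = setlab x m" "setlab x (alab x) = x" "setlab (amap f x) l = amap f (setlab x l)"
  by (auto simp: arr_eq_iff)

lemma setlab_unit [simp]: "setlab (x :: unit arr) u = x"
  by (auto simp: arr_eq_iff)

lemma amap_amap [simp]: "amap f (amap g x) = amap (f \<circ> g) x"
  by (auto simp: arr_eq_iff)

lemma amap_image_image: "amap f ` amap g ` H = amap (f \<circ> g) ` H"
  by (simp add: image_image)

lemma ends_amap [simp]: "ends (amap f x) = f ` ends x"
  by (auto simp: ends_def)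

lemma ends_setlab [simp]: "ends (setlab x l) = ends x"
  by (auto simp: ends_def)

lemma allends_amap [simp]: "allends (amap f ` H) = f ` allends H"
  by (auto simp: allends_def)

lemma allends_mono: "H \<subseteq> G \<Longrightarrow> allends H \<subseteq> allends G"
  by (auto simp: allends_def)

lemma allends_insert: "allends (insert x H) = ends x \<union> allends H"
  by (auto simp: allends_def)

lemma ends_subset_allends: "x \<in> H \<Longrightarrow> ends x \<subseteq> allends H"
  by (auto simp: allends_def)

lemma atl_ends [simp]: "atl x \<in> ends x" and ahd_ends [simp]: "ahd x \<in> ends x"
  by (auto simp: ends_def)

lemma amap_cong: "(\<And>p. p \<in> ends x \<Longrightarrow> f p = g p) \<Longrightarrow> amap f x = amap g x"
  by (auto simp: arr_eq_iff)

lemma amap_image_cong: "(\<And>p. p \<in> allends H \<Longrightarrow> f p = g p) \<Longrightarrow> amap f ` H = amap g ` H"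
  by (intro image_cong refl amap_cong) (auto simp: allends_def)

lemma amap_image_ident: "(\<And>p. p \<in> allends H \<Longrightarrow> f p = p) \<Longrightarrow> amap f ` H = H"
  using amap_image_cong[of H f id] by (simp add: amap_def atl_def ahd_def alab_def)

text \<open>\<open>wf_diag\<close> without the demand that the ends fill an initial segment. Unlike
  \<open>wf_diag\<close> it passes to subsets and to injective relabellings, the level at which
  removals and swaps are studied before renumbering.\<close>

definition chords :: "'s arr set \<Rightarrow> bool" where
  "chords G \<longleftrightarrow> finite G \<and> (\<forall>x\<in>G. atl x \<noteq> ahd x)
     \<and> (\<forall>x\<in>G. \<forall>y\<in>G. x \<noteq> y \<longrightarrow> ends x \<inter> ends y = {})"

lemma wf_diag_chords: "wf_diag G \<longleftrightarrow> chords G \<and> allends G = {..<2 * card G}"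
  by (auto simp: wf_diag_def chords_def)

lemma wf_diag_imp_chords: "wf_diag G \<Longrightarrow> chords G"
  by (simp add: wf_diag_chords)

lemma chords_subset: "chords G \<Longrightarrow> H \<subseteq> G \<Longrightarrow> chords H"
  unfolding chords_def by (meson finite_subset subsetD)

lemma chords_finite: "chords G \<Longrightarrow> finite G"
  by (simp add: chords_def)

lemma wf_diag_finite: "wf_diag G \<Longrightarrow> finite G"
  by (simp add: wf_diag_def)

lemma finite_allends: "finite G \<Longrightarrow> finite (allends G)"
  by (auto simp: allends_def ends_def)

lemma chords_unique: "chords G \<Longrightarrow> x \<in> G \<Longrightarrow> y \<in> G \<Longrightarrow> p \<in> ends x \<Longrightarrow> p \<in> ends y \<Longrightarrow> x = y"
  unfolding chords_def by blast

lemma arr_at_eq: "chords G \<Longrightarrow> x \<in> G \<Longrightarrow> p \<in> ends x \<Longrightarrow> arr_at G p = x"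
  unfolding arr_at_def by (rule the_equality) (auto intro: chords_unique)

lemma arr_at:
  assumes "chords G" "p \<in> allends G"
  shows "arr_at G p \<in> G" "p \<in> ends (arr_at G p)"
proof -
  obtain x where "x \<in> G" "p \<in> ends x" using assms by (auto simp: allends_def)
  then show "arr_at G p \<in> G" "p \<in> ends (arr_at G p)" using arr_at_eq assms(1) by metis+
qed

lemma allends_Int_chords:
  assumes "chords G" "x \<in> G" "p \<in> ends x" "H \<subseteq> G"
  shows "p \<in> allends H \<longleftrightarrow> x \<in> H"
  using assms chords_unique by (fastforce simp: allends_def)

lemma inj_on_amap:
  assumes "inj_on f (allends H)"
  shows "inj_on (amap f) H"
proof (rule inj_onI)
  fix x y assume xy: "x \<in> H" "y \<in> H" "amap f x = amap f y"
  then have eq: "f (atl x) = f (atl y)" "f (ahd x) = f (ahd y)" "alab x = alab y"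
    by (metis amap_sel)+
  have "atl x \<in> allends H" "ahd x \<in> allends H" "atl y \<in> allends H" "ahd y \<in> allends H"
    using xy ends_subset_allends atl_ends ahd_ends by blast+
  then show "x = y" using inj_onD[OF assms] eq by (intro arr_eqI) blast+
qed

lemma chords_amap:
  assumes "chords H" "inj_on f (allends H)"
  shows "chords (amap f ` H)"
  unfolding chords_def
proof (intro conjI ballI impI)
  show "finite (amap f ` H)" using assms by (simp add: chords_def)
next
  fix x assume "x \<in> amap f ` H"
  then obtain y where y: "y \<in> H" "x = amap f y" by auto
  have "atl y \<in> allends H" "ahd y \<in> allends H"
    using y ends_subset_allends atl_ends ahd_ends by blast+
  moreover have "atl y \<noteq> ahd y" using assms y by (simp add: chords_def)
  ultimately show "atl x \<noteq> ahd x" using assms(2) y by (simp add: inj_on_eq_iff)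
next
  fix x y assume "x \<in> amap f ` H" "y \<in> amap f ` H" "x \<noteq> y"
  then obtain x' y' where xy: "x' \<in> H" "x = amap f x'" "y' \<in> H" "y = amap f y'" "x' \<noteq> y'" by blast
  have "ends x' \<inter> ends y' = {}" using assms xy by (simp add: chords_def)
  then have "f ` ends x' \<inter> f ` ends y' = {}"
    using inj_on_image_Int[OF assms(2) ends_subset_allends[OF xy(1)] ends_subset_allends[OF xy(3)]]
    by simp
  then show "ends x \<inter> ends y = {}" by (simp add: xy)
qed

lemma card_allends:
  assumes "chords H"
  shows "card (allends H) = 2 * card H"
proof -
  have "card (allends H) = (\<Sum>x\<in>H. card (ends x))"
    unfolding allends_def using assms
    by (intro card_UN_disjoint) (auto simp: chords_def ends_def)
  also have "\<dots> = (\<Sum>x\<in>H. 2)"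
    using assms by (intro sum.cong refl) (auto simp: ends_def chords_def)
  finally show ?thesis by simp
qed

lemma arr_at_amap:
  assumes "chords H" "inj_on f (allends H)" "p \<in> allends H"
  shows "arr_at (amap f ` H) (f p) = amap f (arr_at H p)"
  using assms arr_at[OF assms(1,3)] by (intro arr_at_eq chords_amap) auto

lemma arr_at_subset:
  assumes "chords G" "H \<subseteq> G" "p \<in> allends H"
  shows "arr_at G p = arr_at H p"
  using assms arr_at[of H p] chords_subset[OF assms(1,2)] by (intro arr_at_eq) auto

section \<open>Ranks and normalised diagrams\<close>

lemma strict_mono_on_less_iff:
  fixes f :: "nat \<Rightarrow> nat"
  assumes "strict_mono_on P f" "p \<in> P" "q \<in> P"
  shows "f p < f q \<longleftrightarrow> p < q"
  using assms by (metis linorder_neqE_nat not_less_iff_gr_or_eq strict_mono_onD)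

text \<open>\<open>f\<close> maps the points of \<open>P\<close> below \<open>p\<close> bijectively
  onto the points of the image below \<open>f p\<close>.\<close>

lemma rank_image:
  fixes f :: "nat \<Rightarrow> nat"
  assumes "strict_mono_on P f" "p \<in> P"
  shows "rank (f ` P) (f p) = rank P p"
proof -
  have "{q \<in> f ` P. q < f p} = f ` {q \<in> P. q < p}"
    using strict_mono_on_less_iff[OF assms(1)] assms(2) by auto
  moreover have "inj_on f {q \<in> P. q < p}"
    using strict_mono_on_imp_inj_on[OF assms(1)] by (rule inj_on_subset) auto
  ultimately show ?thesis unfolding rank_def by (simp add: card_image)
qed

lemma strict_mono_on_rank: "strict_mono_on P (rank P)"
  unfolding rank_def by (intro strict_mono_onI psubset_card_mono) auto

lemma inj_on_rank: "inj_on (rank P) P"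
  by (rule strict_mono_on_imp_inj_on[OF strict_mono_on_rank])

lemma rank_image_self:
  assumes "finite P"
  shows "rank P ` P = {..<card P}"
proof (rule card_subset_eq)
  show "rank P ` P \<subseteq> {..<card P}"
    using assms by (auto simp: rank_def intro!: psubset_card_mono)
  show "card (rank P ` P) = card {..<card P}" by (simp add: card_image inj_on_rank)
qed simp

lemma rank_Suc: "p \<in> P \<Longrightarrow> rank P (Suc p) = Suc (rank P p)"
proof -
  assume "p \<in> P"
  then have "{q \<in> P. q < Suc p} = insert p {q \<in> P. q < p}" by auto
  then show ?thesis by (simp add: rank_def)
qed

text \<open>Removal is normalisation of a set difference (\<open>rem_eq\<close>). Separating the two
  allows normalising swapped or relabelled sets of arrows as well.\<close>

definition std :: "'s arr set \<Rightarrow> 's arr set" where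
  "std H = amap (rank (allends H)) ` H"

lemma cmap_eq: "cmap G X = amap (rank (allends (G - X)))"
  by (simp add: fun_eq_iff cmap_def amap_def)

lemma rem_eq: "rem G X = std (G - X)"
  by (simp add: rem_def cmap_eq std_def)

lemma std_amap:
  assumes "strict_mono_on (allends H) f"
  shows "std (amap f ` H) = std H"
  unfolding std_def allends_amap amap_image_image
  by (rule amap_image_cong) (simp add: rank_image assms)

lemma inj_on_std: "inj_on (amap (rank (allends H))) H"
  by (rule inj_on_amap) (rule inj_on_rank)

lemma card_std: "card (std H) = card H"
  unfolding std_def by (rule card_image) (rule inj_on_std)

lemma wf_diag_std:
  assumes "chords H"
  shows "wf_diag (std H)"
proof -
  have "finite (allends H)" using assms by (intro finite_allends chords_finite)
  then have "allends (std H) = {..<2 * card (std H)}"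
    unfolding card_std unfolding std_def allends_amap
    using rank_image_self[of "allends H"] card_allends[OF assms] by simp
  moreover have "chords (std H)"
    unfolding std_def using assms inj_on_rank by (rule chords_amap)
  ultimately show ?thesis by (simp add: wf_diag_chords)
qed

lemma std_image_Diff:
  assumes "Y \<subseteq> H"
  shows "std H - amap (rank (allends H)) ` Y = amap (rank (allends H)) ` (H - Y)"
  unfolding std_def by (rule inj_on_image_set_diff[OF inj_on_std Diff_subset assms, symmetric])

text \<open>The first renumbering is strictly increasing on all ends, in particular on those that
  stay, so a later normalisation does not see it.\<close>

lemma std_std_Diff:
  assumes "Y \<subseteq> H"
  shows "std (std H - amap (rank (allends H)) ` Y) = std (H - Y)"
  unfolding std_image_Diff[OF assms]
  using monotone_on_subset[OF strict_mono_on_rank allends_mono[OF Diff_subset]] by (rule std_amap)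

lemma wf_diag_rem: "chords G \<Longrightarrow> wf_diag (rem G X)"
  unfolding rem_eq by (rule wf_diag_std) (erule chords_subset, rule Diff_subset)

text \<open>After the removal of \<open>X\<close> the arrows of \<open>Y\<close> have new positions,
  hence the \<open>cmap\<close>. Since the result depends on the union only, removals can be
  exchanged, and subdiagrams of a diagram with arrows removed become subdiagrams of the full
  one.\<close>

lemma rem_rem:
  assumes "Y \<subseteq> G - X"
  shows "rem (rem G X) (cmap G X ` Y) = rem G (X \<union> Y)"
proof -
  have "G - (X \<union> Y) = G - X - Y" by blast
  then show ?thesis unfolding rem_eq cmap_eq using std_std_Diff[OF assms] by metis
qed

section \<open>Forgetting signs and counting signings\<close>

lemma forget_simps [simp]:
  "allends (forget H) = allends H" "forget (insert x H) = insert (setlab x ()) (forget H)"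
  by (auto simp: forget_def allends_def)

lemma forget_amap: "forget (amap f ` H) = amap f ` forget H"
  by (simp add: forget_def image_image)

lemma forget_std: "forget (std H) = std (forget H)"
  unfolding std_def by (simp add: forget_amap)

definition sgnG :: "gauss \<Rightarrow> rat" where
  "sgnG G = (\<Prod>x\<in>G. if alab x then 1 else -1)"

lemma sgnG_amap: "inj_on (amap f) H \<Longrightarrow> sgnG (amap f ` H) = sgnG H"
  unfolding sgnG_def by (subst prod.reindex) auto

lemma sgnG_std: "sgnG (std H) = sgnG H"
  unfolding std_def by (rule sgnG_amap[OF inj_on_std])

lemma inj_on_forget:
  assumes "chords H"
  shows "inj_on (\<lambda>x. setlab x ()) H"
proof (rule inj_onI)
  fix x y assume xy: "x \<in> H" "y \<in> H" "setlab x () = setlab y ()"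
  then have "atl x \<in> ends y" by (metis atl_ends ends_setlab setlab_sel(1))
  then show "x = y" using chords_unique[OF assms xy(1,2), of "atl x"] by simp
qed

text \<open>Disjointness of ends makes forgetting injective, so each arrow of \<open>A\<close> comes
  from one arrow of \<open>H\<close>, whose sign is forced. Hence the sum over signings in
  \<open>S_diag\<close>, and likewise in \<open>S_germ\<close>, has at most one nonzero term at a
  given argument.\<close>

lemma signing_unique:
  assumes "chords H" "forget H = A"
  shows "\<exists>\<sigma>\<in>PiE A (\<lambda>_. UNIV). (\<forall>x\<in>H. \<sigma> (setlab x ()) = alab x) \<and> sgnprod A \<sigma> = sgnG H \<and>
    (\<forall>\<tau>\<in>PiE A (\<lambda>_. UNIV). sign_diag A \<tau> = H \<longleftrightarrow> \<tau> = \<sigma>)"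
proof -
  let ?u = "\<lambda>x :: bool arr. setlab x ()"
  note inj = inj_on_forget[OF assms(1)]
  \<comment> \<open>Members of \<open>PiE\<close> are \<open>undefined\<close> outside
    \<open>A\<close>; the restriction makes the signing unique as a function and not only on
    \<open>A\<close>.\<close>
  define \<sigma> where "\<sigma> = (\<lambda>a\<in>A. alab (the_inv_into H ?u a))"
  have A: "A = ?u ` H" using assms(2) by (simp add: forget_def)
  have lab: "\<sigma> (?u x) = alab x" if "x \<in> H" for x
  proof -
    have "?u x \<in> A" unfolding A using that by (rule imageI)
    then show ?thesis unfolding \<sigma>_def by (simp only: restrict_apply' the_inv_into_f_f[OF inj that])
  qed
  have \<sigma>: "\<sigma> \<in> PiE A (\<lambda>_. UNIV)" by (simp add: \<sigma>_def)
  have "sign_diag A \<sigma> = (\<lambda>x. x) ` H"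
    unfolding sign_diag_def A image_image by (intro image_cong refl) (simp add: lab)
  then have "sign_diag A \<sigma> = H" by simp
  moreover have "\<tau> = \<sigma>" if \<tau>: "\<tau> \<in> PiE A (\<lambda>_. UNIV)" "sign_diag A \<tau> = H" for \<tau>
  proof (rule PiE_ext[OF \<tau>(1) \<sigma>])
    fix a assume "a \<in> A"
    then have "setlab a (\<tau> a) \<in> H" using \<tau>(2) by (auto simp: sign_diag_def)
    from lab[OF this] show "\<tau> a = \<sigma> a" by simp
  qed
  moreover have "sgnprod A \<sigma> = sgnG H"
    unfolding sgnprod_def sgnG_def A by (subst prod.reindex[OF inj]) (simp add: lab)
  ultimately show ?thesis using \<sigma> lab by blast
qed

text \<open>The closed form of the coefficient of \<open>H\<close> in \<open>S_diag A\<close>. It is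
  also what a genuine germ with second diagram \<open>H\<close> contributes to the pairing with
  dA.\<close>

definition val :: "arrowd \<Rightarrow> gauss \<Rightarrow> rat" where
  "val A H = (if forget H = A then sgnG H else 0)"

lemma S_diag_eq:
  assumes "wf_diag H" "finite A"
  shows "S_diag A H = val A H"
proof (cases "forget H = A")
  case True
  obtain \<sigma> where \<sigma>: "\<sigma> \<in> PiE A (\<lambda>_. UNIV)" "sgnprod A \<sigma> = sgnG H"
    "\<forall>\<tau>\<in>PiE A (\<lambda>_. UNIV). sign_diag A \<tau> = H \<longleftrightarrow> \<tau> = \<sigma>"
    using signing_unique[OF conjunct1[OF assms(1)[unfolded wf_diag_chords]] True] by blast
  have "S_diag A H = (\<Sum>\<tau>\<in>PiE A (\<lambda>_. UNIV). if \<tau> = \<sigma> then sgnprod A \<sigma> else 0)"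
    unfolding S_diag_def
  proof (rule sum.cong[OF refl])
    fix \<tau> assume "\<tau> \<in> PiE A (\<lambda>_. UNIV :: bool set)"
    then have "sign_diag A \<tau> = H \<longleftrightarrow> \<tau> = \<sigma>" using \<sigma>(3) by blast
    then show "(if wf_diag (sign_diag A \<tau>) \<and> sign_diag A \<tau> = H then sgnprod A \<tau> else 0) =
      (if \<tau> = \<sigma> then sgnprod A \<sigma> else 0)"
      using assms(1) by presburger
  qed
  also have "\<dots> = sgnG H"
    using \<sigma>(1,2) assms(2) by (simp add: finite_PiE)
  finally show ?thesis using True by (simp add: val_def)
next
  case False
  have "sign_diag A \<sigma> \<noteq> H" for \<sigma>
    using False by (auto simp: sign_diag_def forget_def image_image)
  then show ?thesis using False by (simp add: S_diag_def val_def)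
qed

text \<open>Grouping \<open>T\<close> by the fibres of \<open>f\<close>. \<open>I_diag\<close> and
  \<open>I_germ\<close> weight each subobject by the number of removed sets that produce it, so
  pairing with them becomes a sum over removed sets, whichever of these produce equal
  results.\<close>

lemma sum_count_image:
  fixes u :: "'b \<Rightarrow> rat"
  assumes "finite T"
  shows "(\<Sum>h\<in>f ` T. u h * of_nat (card {X \<in> T. f X = h})) = (\<Sum>X\<in>T. u (f X))"
proof -
  have "(\<Sum>X\<in>T. u (f X)) = (\<Sum>h\<in>f ` T. \<Sum>X\<in>{X \<in> T. f X = h}. u (f X))"
    by (rule sum.image_gen[OF assms])
  also have "\<dots> = (\<Sum>h\<in>f ` T. u h * of_nat (card {X \<in> T. f X = h}))"
    by (intro sum.cong refl) simp
  finally show ?thesis ..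
qed

lemma ip_diag_eq:
  assumes "wf_diag G" "finite A"
  shows "ip_diag (S_diag A) (I_diag G) = (\<Sum>X\<in>Pow G. val A (rem G X))"
proof -
  let ?T = "rem G ` Pow G"
  have fin: "finite (Pow G)" using assms by (simp add: wf_diag_def)
  have I: "I_diag G H = of_nat (card {X \<in> Pow G. rem G X = H})" for H
    unfolding I_diag_def Pow_iff ..
  have "I_diag G H = 0" if "H \<notin> ?T" for H
  proof -
    have "{X \<in> Pow G. rem G X = H} = {}" using that by blast
    then show ?thesis unfolding I by (simp only: card.empty of_nat_0)
  qed
  then have "supp (S_diag A) \<inter> supp (I_diag G) \<subseteq> ?T" unfolding supp_def by blast
  then have "ip_diag (S_diag A) (I_diag G) = (\<Sum>H\<in>?T. S_diag A H * I_diag G H)"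
    unfolding ip_diag_def using fin by (intro sum.mono_neutral_left) (auto simp: supp_def)
  also have "\<dots> = (\<Sum>X\<in>Pow G. S_diag A (rem G X))"
    unfolding I by (rule sum_count_image[OF fin])
  also have "\<dots> = (\<Sum>X\<in>Pow G. val A (rem G X))"
    using S_diag_eq[OF wf_diag_rem[OF wf_diag_imp_chords[OF assms(1)]] assms(2)] by simp
  finally show ?thesis .
qed

section \<open>Swapping adjacent ends\<close>

lemma ends_pair_exists:
  assumes "p \<in> ends x" "atl x \<noteq> ahd x"
  obtains a where "ends x = {p, a}" "a \<noteq> p"
proof (cases "p = atl x")
  case True
  then show thesis using that[of "ahd x"] assms by (simp add: ends_def)
next
  case False
  then show thesis using that[of "atl x"] assms by (simp add: ends_def insert_commute)
qed

text \<open>Crossing depends on the unordered ends only, so one end of each arrow can be singled out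
  without distinguishing heads from tails.\<close>

lemma crosses_iff:
  assumes "ends x = {p, a}" "ends y = {q, b}"
  shows "crosses x y \<longleftrightarrow> (min p a < q \<and> q < max p a) \<noteq> (min p a < b \<and> b < max p a)"
proof -
  have "atl x = p \<and> ahd x = a \<or> atl x = a \<and> ahd x = p"
    using assms(1) by (simp add: ends_def doubleton_eq_iff)
  then have between: "between x r \<longleftrightarrow> min p a < r \<and> r < max p a" for r
    unfolding between_def by (metis min.commute max.commute)
  have "atl y = q \<and> ahd y = b \<or> atl y = b \<and> ahd y = q"
    using assms(2) by (simp add: ends_def doubleton_eq_iff)
  then show ?thesis
    unfolding crosses_def between by metis
qed

lemma between_strict_mono:
  assumes "strict_mono_on P f" "ends x \<subseteq> P" "p \<in> P"
  shows "between (amap f x) (f p) \<longleftrightarrow> between x p"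
proof -
  have "atl x \<in> P" "ahd x \<in> P" using assms(2) by (auto simp: ends_def)
  note iff = strict_mono_on_less_iff[OF assms(1)] this assms(3)
  show ?thesis
    unfolding between_def by (simp add: min_less_iff_disj less_max_iff_disj iff)
qed

lemma crosses_strict_mono:
  assumes "strict_mono_on P f" "ends x \<subseteq> P" "ends y \<subseteq> P"
  shows "crosses (amap f x) (amap f y) \<longleftrightarrow> crosses x y"
proof -
  have "atl y \<in> P" "ahd y \<in> P" using assms(3) by (auto simp: ends_def)
  then show ?thesis
    unfolding crosses_def by (simp add: between_strict_mono[OF assms(1,2)])
qed

text \<open>Moving the adjacent ends \<open>p\<close> and \<open>Suc p\<close> past each other
  toggles the interlacing, provided that the other ends \<open>a\<close> and \<open>b\<close> stay
  on their side of this pair and keep their mutual order. \<open>y\<close> comes first in the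
  conclusion because its end is the lower one after the swap.\<close>

lemma crosses_adjacent_swap:
  assumes "ends x = {p, a}" "ends y = {Suc p, b}" "f p = Suc p" "f (Suc p) = p"
    and "a \<notin> {p, Suc p, b}" "b \<notin> {p, Suc p}"
    and "f a < p \<longleftrightarrow> a < p" "f a > Suc p \<longleftrightarrow> a > Suc p"
    and "f b < p \<longleftrightarrow> b < p" "f b > Suc p \<longleftrightarrow> b > Suc p"
    and "f a < f b \<longleftrightarrow> a < b" "f b < f a \<longleftrightarrow> b < a"
  shows "crosses (amap f y) (amap f x) \<longleftrightarrow> \<not> crosses x y"
proof -
  have "ends (amap f x) = {Suc p, f a}" "ends (amap f y) = {p, f b}"
    using assms(1-4) by simp_all
  from crosses_iff[OF this(2,1)]
  have *: "crosses (amap f y) (amap f x) \<longleftrightarrow>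
      (min p (f b) < Suc p \<and> Suc p < max p (f b)) \<noteq> (min p (f b) < f a \<and> f a < max p (f b))" .
  show ?thesis
    unfolding * crosses_iff[OF assms(1,2)] min_less_iff_disj less_max_iff_disj
    using assms(5-12) by (smt (verit) insert_iff lessI linorder_neqE_nat not_less_iff_gr_or_eq not_less_eq)
qed

text \<open>Edge \<open>j\<close> has the ends \<open>j - 1\<close> and \<open>j\<close>, so this
  says that no two edges of \<open>E\<close> share an end and that \<open>j - 1\<close> is never
  truncated. Then \<open>swapE\<close> exchanges ends in disjoint pairs and is an
  involution.\<close>

definition sparse :: "nat set \<Rightarrow> bool" where
  "sparse E \<longleftrightarrow> 0 \<notin> E \<and> (\<forall>j\<in>E. Suc j \<notin> E)"

lemma sparse_subset: "sparse E \<Longrightarrow> F \<subseteq> E \<Longrightarrow> sparse F"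
  by (auto simp: sparse_def)

lemma swapE_edge:
  assumes "sparse E" "j \<in> E"
  shows "swapE E j = j - 1" "swapE E (j - 1) = j" "Suc (j - 1) = j"
  using assms by (auto simp: sparse_def swapE_def) (metis One_nat_def Suc_pred gr0I)+

lemma swapE_fixed: "p \<notin> E \<Longrightarrow> Suc p \<notin> E \<Longrightarrow> swapE E p = p"
  by (simp add: swapE_def)

lemma swapE_cases [consumes 1, case_names upper lower fixed]:
  assumes "sparse E"
  obtains (upper) q where "p = Suc q" "p \<in> E" "q \<notin> E" "swapE E p = q" "swapE E q = p"
  | (lower) "Suc p \<in> E" "p \<notin> E" "swapE E p = Suc p" "swapE E (Suc p) = p"
  | (fixed) "p \<notin> E" "Suc p \<notin> E" "swapE E p = p"
proof (cases "p \<in> E")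
  case True
  then obtain q where "p = Suc q" using assms by (cases p) (auto simp: sparse_def)
  then show thesis using upper True assms by (auto simp: sparse_def swapE_def)
next
  case False
  then show thesis using lower fixed assms by (cases "Suc p \<in> E") (auto simp: sparse_def swapE_def)
qed

lemma swapE_swapE: "sparse E \<Longrightarrow> swapE E (swapE E p) = p"
  by (rule swapE_cases[of E p]) auto

lemma swapE_comp: "sparse E \<Longrightarrow> swapE E \<circ> swapE E = id"
  by (auto simp: swapE_swapE)

lemma inj_swapE: "sparse E \<Longrightarrow> inj_on (swapE E) A"
  by (metis inj_on_inverseI swapE_swapE)

lemma amap_swapE_involution: "sparse E \<Longrightarrow> amap (swapE E) ` amap (swapE E) ` H = H"
  by (simp add: amap_image_image swapE_comp) (simp add: amap_image_ident)

lemma swapE_image_iff: "sparse E \<Longrightarrow> p \<in> swapE E ` P \<longleftrightarrow> swapE E p \<in> P"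
  by (metis image_iff swapE_swapE)

text \<open>The exchanged pairs are disjoint and consist of neighbours, so the only order that the
  swap can reverse is that of the two ends of one edge in \<open>E\<close>.\<close>

lemma swapE_less:
  assumes "sparse E" "p < q" "q = Suc p \<Longrightarrow> q \<notin> E"
  shows "swapE E p < swapE E q"
proof -
  have "p \<in> E \<longrightarrow> 0 < p" "q \<in> E \<and> Suc p \<in> E \<longrightarrow> q \<noteq> Suc (Suc p)"
    "q \<in> E \<or> Suc p \<in> E \<longrightarrow> q \<noteq> Suc p"
    using assms by (auto simp: sparse_def intro: gr0I)
  then show ?thesis
    unfolding swapE_def using assms(2)
    by (cases "p \<in> E"; cases "Suc p \<in> E"; cases "q \<in> E"; cases "Suc q \<in> E") auto
qed

lemma swapE_less_iff:
  assumes "sparse E" "\<not> (q = Suc p \<and> q \<in> E)" "\<not> (p = Suc q \<and> p \<in> E)"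
  shows "swapE E p < swapE E q \<longleftrightarrow> p < q"
  using swapE_less[OF assms(1), of p q] swapE_less[OF assms(1), of q p] assms(2,3)
  by (cases p q rule: linorder_cases) auto

lemma swapE_less_edge:
  assumes "sparse E" "Suc p \<in> E" "a \<noteq> p" "a \<noteq> Suc p"
  shows "swapE E a < p \<longleftrightarrow> a < p" "Suc p < swapE E a \<longleftrightarrow> Suc p < a"
proof -
  have e: "swapE E (Suc p) = p" "swapE E p = Suc p" using swapE_edge[OF assms(1,2)] by simp_all
  have "swapE E a < swapE E (Suc p) \<longleftrightarrow> a < Suc p"
    using assms by (intro swapE_less_iff) (auto simp: sparse_def)
  then show "swapE E a < p \<longleftrightarrow> a < p" using e assms(3) by auto
  have "swapE E p < swapE E a \<longleftrightarrow> p < a"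
    using assms by (intro swapE_less_iff) (auto simp: sparse_def)
  then show "Suc p < swapE E a \<longleftrightarrow> Suc p < a" using e assms(4) by auto
qed

text \<open>Serves both R3 with at least two distinguished arrows removed and R2 with one removed:
  in either case every edge of \<open>E\<close> has lost an end.\<close>

lemma swapE_strict_mono_on:
  assumes "sparse E" "\<And>j. j \<in> E \<Longrightarrow> j - 1 \<notin> P \<or> j \<notin> P"
  shows "strict_mono_on P (swapE E)"
proof (rule strict_mono_onI)
  fix p q assume "p \<in> P" "q \<in> P" "p < q"
  then show "swapE E p < swapE E q"
    using assms(2)[of q] by (intro swapE_less assms(1)) auto
qed

lemma swapE_image_full:
  assumes "sparse E" "\<And>j. j \<in> E \<Longrightarrow> j - 1 \<in> P \<longleftrightarrow> j \<in> P"
  shows "swapE E ` P = P"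
proof -
  have *: "swapE E p \<in> P" if "p \<in> P" for p
  using assms(1) proof (cases rule: swapE_cases[where p = p])
    case upper
    then show ?thesis using assms(2)[of p] that by simp
  next
    case lower
    then show ?thesis using assms(2)[of "Suc p"] that by simp
  next
    case fixed
    then show ?thesis using that by simp
  qed
  show ?thesis using * by (force simp: swapE_image_iff[OF assms(1)] swapE_swapE[OF assms(1)] intro: rev_image_eqI)
qed

text \<open>The distinguished edges that survive when only the ends in \<open>P\<close> are left. A
  3-germ keeps all three if no distinguished arrow is removed, one if one is removed, and none if
  two or more are.\<close>

definition both :: "nat set \<Rightarrow> nat set \<Rightarrow> nat set" where
  "both E P = {j \<in> E. j - 1 \<in> P \<and> j \<in> P}"

lemma bothI: "j \<in> E \<Longrightarrow> j - 1 \<in> P \<Longrightarrow> j \<in> P \<Longrightarrow> j \<in> both E P"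
  by (simp add: both_def)

lemma rank_edge:
  assumes "sparse E" "j \<in> both E P"
  shows "rank P j = Suc (rank P (j - 1))"
  using assms rank_Suc[of "j - 1" P] swapE_edge(3)[of E j] by (simp add: both_def)

text \<open>Renumbering may bring surviving edges closer together but cannot make them share an end,
  because \<open>rank P\<close> is injective on \<open>P\<close>.\<close>

lemma sparse_rank_image:
  assumes "sparse E" "F = both E P"
  shows "sparse (rank P ` F)"
  unfolding sparse_def
proof (intro conjI ballI notI)
  assume "0 \<in> rank P ` F"
  then show False using rank_edge[OF assms(1), of _ P] by (auto simp: assms(2))
next
  fix r assume "r \<in> rank P ` F" "Suc r \<in> rank P ` F"
  then obtain i j where ij: "i \<in> both E P" "j \<in> both E P" "r = rank P i" "Suc r = rank P j"
    by (auto simp: assms(2))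
  then have "rank P i = rank P (j - 1)" using rank_edge[OF assms(1) ij(2)] by simp
  then have "i = j - 1" using ij inj_onD[OF inj_on_rank] by (simp add: both_def)
  then show False using ij swapE_edge(3)[OF assms(1), of j] assms(1) by (metis (lifting) both_def mem_Collect_eq sparse_def)
qed

text \<open>Restricted to the surviving edges, the swap maps \<open>P\<close> to itself. The ends of
  such an edge have consecutive ranks, and the case \<open>fixed\<close> checks that no end outside
  these edges becomes an end of a renumbered one.\<close>

lemma rank_swapE_both:
  assumes "sparse E" "p \<in> P"
  shows "swapE (rank P ` both E P) (rank P p) = rank P (swapE (both E P) p)" (is "?l = ?r")
    and "swapE (both E P) p \<in> P"
proof -
  let ?F = "both E P"
  have F: "sparse ?F" by (rule sparse_subset[OF assms(1)]) (auto simp: both_def)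
  have mem: "rank P q \<in> rank P ` ?F \<longleftrightarrow> q \<in> ?F" if "q \<in> P" for q
    by (rule inj_on_image_mem_iff[OF inj_on_rank that]) (auto simp: both_def)
  have "?l = ?r \<and> swapE ?F p \<in> P"
  using F proof (cases rule: swapE_cases[where p = p])
    case (upper q)
    then have "q \<in> P" by (simp add: both_def)
    moreover have "rank P p = Suc (rank P q)" using rank_edge[OF assms(1) upper(2)] upper(1) by simp
    moreover have "rank P p \<in> rank P ` ?F" using upper(2) by (rule imageI)
    ultimately show ?thesis using upper by (simp add: swapE_def)
  next
    case lower
    then have "Suc p \<in> P" by (simp add: both_def)
    then show ?thesis
      using lower mem[OF assms(2)] mem[of "Suc p"] rank_Suc[OF assms(2)] by (auto simp: swapE_def)
  next
    case fixed
    have "Suc (rank P p) \<notin> rank P ` ?F"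
    proof
      assume "Suc (rank P p) \<in> rank P ` ?F"
      then obtain j where j: "j \<in> ?F" "Suc (rank P p) = rank P j" by auto
      then have "rank P p = rank P (j - 1)" using rank_edge[OF assms(1) j(1)] by simp
      then have "p = j - 1" using j assms(2) inj_onD[OF inj_on_rank] by (simp add: both_def)
      then show False using fixed(2) swapE_edge(3)[OF F j(1)] j(1) by simp
    qed
    then show ?thesis using fixed mem[OF assms(2)] assms(2) by (auto simp: swapE_def)
  qed
  then show "?l = ?r" "swapE ?F p \<in> P" by auto
qed

text \<open>On \<open>P\<close>, the swap along \<open>E\<close> is the swap along the edges with both ends in \<open>P\<close>,
  followed by an order-preserving map.\<close>

lemma rank_swapE_image:
  assumes "sparse E" "p \<in> P"
  shows "rank (swapE E ` P) (swapE E p) = rank P (swapE (both E P) p)"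
proof -
  let ?h = "swapE (both E P)"
  have F: "sparse (both E P)" by (rule sparse_subset[OF assms(1)]) (auto simp: both_def)
  have hP: "?h q \<in> P" if "q \<in> P" for q by (rule rank_swapE_both(2)[OF assms(1) that])
  \<comment> \<open>\<open>?h\<close> undoes the swap along surviving edges, so on \<open>P\<close>
    the composite is the identity there and moves only ends whose partner is missing.\<close>
  have "strict_mono_on P (swapE E \<circ> ?h)"
  proof (rule strict_mono_onI)
    fix p q assume pq: "p \<in> P" "q \<in> P" "p < q"
    show "(swapE E \<circ> ?h) p < (swapE E \<circ> ?h) q"
    proof (cases "q = Suc p \<and> q \<in> E")
      case True
      then have q: "q = Suc p" "Suc p \<in> E" by auto
      then have "Suc p \<in> both E P" using pq by (simp add: both_def)
      then show ?thesis
        using swapE_edge(1,2)[OF F, of "Suc p"] swapE_edge(1,2)[OF assms(1) q(2)] by (simp add: q(1))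
    next
      case False
      have less: "?h p < ?h q"
        using False by (intro swapE_less[OF F pq(3)]) (auto simp: both_def)
      \<comment> \<open>A reversal could happen only on an edge of \<open>E\<close> with both ends
        in \<open>P\<close>. \<open>?h\<close> would already have exchanged these ends, which forces
        \<open>q\<close> below \<open>p\<close>.\<close>
      have "swapE E (?h p) < swapE E (?h q)"
      proof (rule swapE_less[OF assms(1) less], rule notI)
        assume *: "?h q = Suc (?h p)" "?h q \<in> E"
        then have "?h q - 1 \<in> P" using hP[OF pq(1)] by simp
        then have "?h q \<in> both E P" using hP[OF pq(2)] *(2) by (intro bothI)
        from swapE_edge(1)[OF F this] have "?h (?h q) = ?h p" using *(1) by simp
        then have "q = ?h p" "p = ?h q" using swapE_swapE[OF F] by metis+
        then show False using less pq(3) by simp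
      qed
      then show ?thesis by simp
    qed
  qed
  from rank_image[OF this hP[OF assms(2)]]
  have "rank ((swapE E \<circ> ?h) ` P) (swapE E p) = rank P (?h p)"
    by (simp add: swapE_swapE[OF F])
  moreover have "?h ` P = P" using F by (rule swapE_image_full) (auto simp: both_def)
  ultimately show ?thesis by (metis image_comp)
qed

text \<open>Renumbering turns the swap along \<open>E\<close> into the swap along the renumbered
  surviving edges. This is why removing corresponding arrows from both diagrams of a 3-germ leaves
  two diagrams that again differ by a swap.\<close>

lemma rank_swapE:
  assumes "sparse E" "p \<in> P"
  shows "swapE (rank P ` both E P) (rank P p) = rank (swapE E ` P) (swapE E p)"
  using rank_swapE_both(1)[OF assms] rank_swapE_image[OF assms] by simp

text \<open>\<open>sub\<close> numbers the edges of a subgerm in G1. Numbering them in G0 gives the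
  same result, since the swap only exchanges the two ends of each surviving edge; reversing a
  subgerm depends on this.\<close>

lemma rank_both_swapE_image:
  assumes "sparse E"
  shows "rank (swapE E ` P) ` both E (swapE E ` P) = rank P ` both E P"
proof -
  have F: "sparse (both E P)" by (rule sparse_subset[OF assms(1)]) (auto simp: both_def)
  have eq: "both E (swapE E ` P) = both E P"
  proof -
    have "j - 1 \<in> swapE E ` P \<longleftrightarrow> j \<in> P" "j \<in> swapE E ` P \<longleftrightarrow> j - 1 \<in> P" if "j \<in> E" for j
      unfolding swapE_image_iff[OF assms] using swapE_edge[OF assms that] by metis+
    then show ?thesis unfolding both_def by blast
  qed
  show ?thesis
    unfolding eq
  proof (rule image_cong[OF refl])
    fix j assume j: "j \<in> both E P"
    then have "rank (swapE E ` P) (swapE E (j - 1)) = rank P (swapE (both E P) (j - 1))"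
      by (intro rank_swapE_image[OF assms]) (simp add: both_def)
    then show "rank (swapE E ` P) j = rank P j"
      using swapE_edge[OF assms, of j] swapE_edge[OF F j] j by (simp add: both_def)
  qed
qed

section \<open>R3 configurations\<close>

text \<open>The conditions that \<open>r3_germ\<close> puts on G0 and the edges, isolated so that
  they can be carried over to G1 and to subdiagrams.\<close>

definition r3conf :: "gauss \<Rightarrow> nat set \<Rightarrow> bool" where
  "r3conf G E \<longleftrightarrow> card E = 3 \<and> (\<forall>j\<in>E. two_arrow_edge G j)
     \<and> card (\<Union>j\<in>E. {j - 1, j}) = 6
     \<and> card (\<Union>j\<in>E. edge_arrows G j) = 3 \<and> inj_on (edge_arrows G) E
     \<and> (\<exists>c. \<forall>j\<in>E. wsgn G j * eps G j = c) \<and> inj_on (ups G) E"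

lemma r3_germ_iff:
  "r3_germ g \<longleftrightarrow> gkind g = 3 \<and> wf_diag (gG0 g) \<and> r3conf (gG0 g) (gE g)
     \<and> gG1 g = amap (swapE (gE g)) ` gG0 g"
  unfolding r3_germ_def r3conf_def by blast

text \<open>If two of the three edges shared an end, the three would have at most five ends in
  total, not six.\<close>

lemma r3conf_sparse:
  assumes "r3conf G E"
  shows "sparse E"
  unfolding sparse_def
proof (intro conjI ballI notI)
  show "0 \<in> E \<Longrightarrow> False" using assms unfolding r3conf_def two_arrow_edge_def by fastforce
next
  fix j assume j: "j \<in> E" "Suc j \<in> E"
  have fin: "finite E" and card: "card E = 3" using assms unfolding r3conf_def by (auto intro: card_ge_0_finite)
  have "card (E - {j, Suc j}) = 1" using j fin card by (simp add: card_Diff_subset)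
  then obtain k where "E - {j, Suc j} = {k}" by (auto simp: card_1_singleton_iff)
  then have "(\<Union>j\<in>E. {j - 1, j}) \<subseteq> {j - 1, j, Suc j, k - 1, k}" by fastforce
  then have "card (\<Union>j\<in>E. {j - 1, j}) \<le> card {j - 1, j, Suc j, k - 1, k}" by (intro card_mono) auto
  also have "\<dots> \<le> 5" by (auto simp: card_insert_if)
  finally show False using assms unfolding r3conf_def by simp
qed

lemma r3conf_allends:
  assumes "wf_diag G" "r3conf G E" "j \<in> E"
  shows "j \<in> allends G" "j - 1 \<in> allends G"
  using assms unfolding wf_diag_def r3conf_def two_arrow_edge_def by fastforce+

text \<open>Covers two relabellings at once: renumbering after a removal, which keeps crossings
  (\<open>s = 1\<close>), and the R3 swap, which toggles them at all three edges
  (\<open>s = -1\<close>). Heads, signs and incidences travel with \<open>f\<close> even when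
  \<open>f\<close> exchanges the ends of an edge. Only \<open>eta\<close> reacts, and the factor
  \<open>s\<close> turns the common value \<open>c\<close> into \<open>s * c\<close>.\<close>

lemma r3conf_transport:
  fixes e :: "nat \<Rightarrow> nat"
  assumes G: "chords G" "r3conf G E" and H: "H \<subseteq> G" "inj_on f (allends H)" "wf_diag (amap f ` H)"
    and e: "inj_on e E" "\<And>j. j \<in> E \<Longrightarrow> 1 \<le> e j"
      "\<And>j. j \<in> E \<Longrightarrow> f (j - 1) = e j - 1 \<and> f j = e j \<or> f (j - 1) = e j \<and> f j = e j - 1"
    and mem: "\<And>j. j \<in> E \<Longrightarrow> j - 1 \<in> allends H" "\<And>j. j \<in> E \<Longrightarrow> j \<in> allends H"
    and eta: "\<And>j. j \<in> E \<Longrightarrow> eta (amap f ` H) (e j) = s * eta G j"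
  shows "r3conf (amap f ` H) (e ` E)"
proof -
  let ?H = "amap f ` H"
  have cH: "chords H" by (rule chords_subset[OF G(1) H(1)])
  have at: "arr_at ?H (f p) = amap f (arr_at G p)" "arr_at G p \<in> H"
    "f (ahd (arr_at G p)) = f p \<longleftrightarrow> ahd (arr_at G p) = p" if p: "p \<in> allends H" for p
  proof -
    have eq: "arr_at G p = arr_at H p" by (rule arr_at_subset[OF G(1) H(1) p])
    show "arr_at ?H (f p) = amap f (arr_at G p)" unfolding eq by (rule arr_at_amap[OF cH H(2) p])
    show *: "arr_at G p \<in> H" unfolding eq by (rule arr_at(1)[OF cH p])
    have "ahd (arr_at G p) \<in> allends H" using ends_subset_allends[OF *] ahd_ends by blast
    then show "f (ahd (arr_at G p)) = f p \<longleftrightarrow> ahd (arr_at G p) = p"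
      using inj_on_eq_iff[OF H(2) _ p] by blast
  qed
  note inj = inj_on_amap[OF H(2)]
  have edge: "edge_arrows ?H (e j) = amap f ` edge_arrows G j"
    and ups: "ups ?H (e j) = ups G j" and wsgn: "wsgn ?H (e j) = wsgn G j"
    and ne: "arr_at ?H (e j - 1) \<noteq> arr_at ?H (e j)" and ee: "{e j - 1, e j} = f ` {j - 1, j}"
    if j: "j \<in> E" for j
  proof -
    note a1 = at[OF mem(1)[OF j]] and a2 = at[OF mem(2)[OF j]]
    have "arr_at G (j - 1) \<noteq> arr_at G j"
      using G(2) j unfolding r3conf_def two_arrow_edge_def by blast
    then have ne': "amap f (arr_at G (j - 1)) \<noteq> amap f (arr_at G j)"
      using inj_on_eq_iff[OF inj a1(2) a2(2)] by blast
    consider "e j - 1 = f (j - 1)" "e j = f j" | "e j = f (j - 1)" "e j - 1 = f j"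
      using e(3)[OF j] by force
    then have "edge_arrows ?H (e j) = amap f ` edge_arrows G j \<and> ups ?H (e j) = ups G j \<and>
      wsgn ?H (e j) = wsgn G j \<and> arr_at ?H (e j - 1) \<noteq> arr_at ?H (e j) \<and> {e j - 1, e j} = f ` {j - 1, j}"
    proof cases
      case 1
      then show ?thesis
        unfolding edge_arrows_def ups_def wsgn_def sgnv_def unfolding 1(1) unfolding 1(2)
        unfolding a1(1) a2(1) amap_sel a1(3) a2(3)
        using ne' by simp
    next
      case 2
      then show ?thesis
        unfolding edge_arrows_def ups_def wsgn_def sgnv_def unfolding 2(2) unfolding 2(1)
        unfolding a1(1) a2(1) amap_sel a1(3) a2(3)
        using ne' by auto
    qed
    then show "edge_arrows ?H (e j) = amap f ` edge_arrows G j" "ups ?H (e j) = ups G j"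
      "wsgn ?H (e j) = wsgn G j" "arr_at ?H (e j - 1) \<noteq> arr_at ?H (e j)"
      "{e j - 1, e j} = f ` {j - 1, j}" by blast+
  qed
  have sub: "edge_arrows G j \<subseteq> H" if "j \<in> E" for j
    unfolding edge_arrows_def using at(2) mem that by blast
  have "card (e ` E) = 3" using G(2) e(1) by (simp add: card_image r3conf_def)
  moreover have "two_arrow_edge ?H (e j)" if j: "j \<in> E" for j
  proof -
    have "e j \<in> f ` allends H" using ee[OF j] mem[OF j] by blast
    then have "e j < 2 * card ?H" using H(3) by (simp add: wf_diag_chords)
    then show ?thesis using e(2)[OF j] ne[OF j] by (simp add: two_arrow_edge_def)
  qed
  moreover have "card (\<Union>j\<in>e ` E. {j - 1, j}) = 6"
  proof -
    have "(\<Union>j\<in>e ` E. {j - 1, j}) = (\<Union>j\<in>E. f ` {j - 1, j})" using ee by simp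
    also have "\<dots> = f ` (\<Union>j\<in>E. {j - 1, j})" by blast
    finally show ?thesis
      using G(2) mem by (simp add: r3conf_def card_image[OF inj_on_subset[OF H(2)]] UN_subset_iff)
  qed
  moreover have "card (\<Union>j\<in>e ` E. edge_arrows ?H j) = 3"
  proof -
    have "(\<Union>j\<in>e ` E. edge_arrows ?H j) = amap f ` (\<Union>j\<in>E. edge_arrows G j)"
      using edge by (simp add: image_UN)
    then show ?thesis
      using G(2) sub by (simp add: r3conf_def card_image[OF inj_on_subset[OF inj]] UN_subset_iff)
  qed
  moreover have "inj_on (edge_arrows ?H) (e ` E)"
  proof (rule inj_onI)
    fix i j assume "i \<in> e ` E" "j \<in> e ` E" and eq: "edge_arrows ?H i = edge_arrows ?H j"
    then obtain i' j' where ij: "i' \<in> E" "i = e i'" "j' \<in> E" "j = e j'" by blast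
    then have "amap f ` edge_arrows G i' = amap f ` edge_arrows G j'" using edge eq by simp
    then have "edge_arrows G i' = edge_arrows G j'"
      using inj_on_image_eq_iff[OF inj sub[OF ij(1)] sub[OF ij(3)]] by blast
    then have "i' = j'" using G(2) ij inj_onD unfolding r3conf_def by metis
    then show "i = j" using ij by simp
  qed
  moreover have "\<exists>c. \<forall>j\<in>e ` E. wsgn ?H j * eps ?H j = c"
  proof -
    obtain c where c: "\<forall>j\<in>E. wsgn G j * eps G j = c" using G(2) unfolding r3conf_def by blast
    have "wsgn ?H (e j) * eps ?H (e j) = s * c" if "j \<in> E" for j
    proof -
      have "wsgn ?H (e j) * eps ?H (e j) = s * (wsgn G j * eps G j)"
        by (simp add: eps_def eta[OF that] ups[OF that] wsgn[OF that])
      then show ?thesis using c that by simp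
    qed
    then show ?thesis by blast
  qed
  moreover have "inj_on (ups ?H) (e ` E)"
  proof (rule inj_onI)
    fix i j assume "i \<in> e ` E" "j \<in> e ` E" and eq: "ups ?H i = ups ?H j"
    then obtain i' j' where ij: "i' \<in> E" "i = e i'" "j' \<in> E" "j = e j'" by blast
    then have "ups G i' = ups G j'" using ups eq by simp
    then have "i' = j'" using G(2) ij inj_onD unfolding r3conf_def by metis
    then show "i = j" using ij by simp
  qed
  ultimately show ?thesis unfolding r3conf_def by blast
qed

lemma r3conf_rem:
  assumes "wf_diag G" "r3conf G E" "both E (allends (G - X)) = E"
  shows "r3conf (rem G X) (rank (allends (G - X)) ` E)"
proof -
  let ?P = "allends (G - X)"
  let ?f = "rank ?P"
  have cG: "chords G" by (rule wf_diag_imp_chords[OF assms(1)])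
  have cH: "chords (G - X)" by (rule chords_subset[OF cG Diff_subset])
  have mem: "j - 1 \<in> ?P" "j \<in> ?P" if "j \<in> E" for j
    using assms(3) that unfolding both_def by blast+
  have r: "?f j = Suc (?f (j - 1))" if "j \<in> E" for j
    using rank_edge[OF r3conf_sparse[OF assms(2)]] assms(3) that by metis
  have eta: "eta (amap ?f ` (G - X)) (?f j) = 1 * eta G j" if j: "j \<in> E" for j
  proof -
    have at: "arr_at (amap ?f ` (G - X)) (?f p) = amap ?f (arr_at G p)" "ends (arr_at G p) \<subseteq> ?P"
      if p: "p \<in> ?P" for p
    proof -
      have eq: "arr_at G p = arr_at (G - X) p" by (rule arr_at_subset[OF cG Diff_subset p])
      show "arr_at (amap ?f ` (G - X)) (?f p) = amap ?f (arr_at G p)"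
        unfolding eq by (rule arr_at_amap[OF cH inj_on_rank p])
      show "ends (arr_at G p) \<subseteq> ?P"
        unfolding eq by (rule ends_subset_allends[OF arr_at(1)[OF cH p]])
    qed
    have "?f j - 1 = ?f (j - 1)" using r[OF j] by simp
    then have "eta (amap ?f ` (G - X)) (?f j) =
      (if crosses (amap ?f (arr_at G (j - 1))) (amap ?f (arr_at G j)) then 1 else - 1)"
      unfolding eta_def by (simp only: at(1)[OF mem(1)[OF j]] at(1)[OF mem(2)[OF j]])
    then show ?thesis
      unfolding crosses_strict_mono[OF strict_mono_on_rank at(2)[OF mem(1)[OF j]] at(2)[OF mem(2)[OF j]]]
      by (simp add: eta_def)
  qed
  have injE: "inj_on ?f E" by (rule inj_on_subset[OF inj_on_rank]) (use mem in blast)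
  have wf: "wf_diag (amap ?f ` (G - X))" using wf_diag_std[OF cH] by (simp add: std_def)
  show ?thesis
    unfolding rem_eq std_def
    by (rule r3conf_transport[OF cG assms(2) Diff_subset inj_on_rank wf injE _ _ mem eta]) (simp_all add: r)
qed

lemma wf_diag_swapE:
  assumes "wf_diag G" "r3conf G E"
  shows "wf_diag (amap (swapE E) ` G)" "swapE E ` allends G = allends G"
proof -
  have sp: "sparse E" by (rule r3conf_sparse[OF assms(2)])
  show eq: "swapE E ` allends G = allends G"
    using r3conf_allends[OF assms] by (intro swapE_image_full[OF sp]) simp
  have "card (amap (swapE E) ` G) = card G" by (intro card_image inj_on_amap inj_swapE[OF sp])
  moreover have "allends (amap (swapE E) ` G) = allends G" by (simp add: eq)
  ultimately show "wf_diag (amap (swapE E) ` G)"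
    using assms(1) chords_amap[OF _ inj_swapE[OF sp], of G] unfolding wf_diag_chords by metis
qed

text \<open>The two arrows at each distinguished edge change from crossing to not crossing or back.
  So \<open>eta\<close> is negated at all three edges, and the common value in the sign condition
  merely changes sign.\<close>

lemma r3conf_swap:
  assumes "wf_diag G" "r3conf G E"
  shows "r3conf (amap (swapE E) ` G) E"
proof -
  let ?f = "swapE E"
  have cG: "chords G" by (rule wf_diag_imp_chords[OF assms(1)])
  have sp: "sparse E" by (rule r3conf_sparse[OF assms(2)])
  note mem = r3conf_allends[OF assms]
  have eta: "eta (amap ?f ` G) j = -1 * eta G j" if j: "j \<in> E" for j
  proof -
    define p where "p = j - 1"
    have jp: "j = Suc p" using swapE_edge(3)[OF sp j] by (simp add: p_def)
    have f: "?f p = Suc p" "?f (Suc p) = p" using swapE_edge[OF sp j] by (simp_all add: jp)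
    define x y where "x = arr_at G p" and "y = arr_at G (Suc p)"
    have P: "p \<in> allends G" "Suc p \<in> allends G" using mem[OF j] by (simp_all add: jp)
    have x: "x \<in> G" "p \<in> ends x" and y: "y \<in> G" "Suc p \<in> ends y"
      unfolding x_def y_def using arr_at[OF cG] P by blast+
    have xy: "x \<noteq> y"
      using assms(2) j unfolding r3conf_def two_arrow_edge_def x_def y_def jp by fastforce
    then have disj: "ends x \<inter> ends y = {}" using cG x y unfolding chords_def by blast
    obtain a where a: "ends x = {p, a}" "a \<noteq> p"
      using ends_pair_exists[OF x(2)] cG x(1) unfolding chords_def by metis
    obtain b where b: "ends y = {Suc p, b}" "b \<noteq> Suc p"
      using ends_pair_exists[OF y(2)] cG y(1) unfolding chords_def by metis
    have ab: "a \<noteq> b" "a \<noteq> Suc p" "b \<noteq> p" using disj a b by auto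
    \<comment> \<open>The far ends \<open>a\<close> and \<open>b\<close> could be reversed only if
      they bounded a distinguished edge themselves. The same two arrows would then bound two
      distinguished edges, against the injectivity of \<open>edge_arrows\<close>.\<close>
    have no: False if "{c, d} = {a, b}" "d = Suc c" "d \<in> E" for c d
    proof -
      have "arr_at G a = x" "arr_at G b = y"
        using a b x y by (auto intro!: arr_at_eq[OF cG])
      then have "edge_arrows G d = {x, y}"
        using that unfolding edge_arrows_def by (auto simp: doubleton_eq_iff)
      moreover have "edge_arrows G j = {x, y}" by (simp add: edge_arrows_def x_def y_def jp)
      ultimately have "d = j" using assms(2) j that(3) unfolding r3conf_def inj_on_def by metis
      then show False using that(1,2) jp a(2) b(2) ab by (auto simp: doubleton_eq_iff)
    qed
    have ff: "?f a < ?f b \<longleftrightarrow> a < b" "?f b < ?f a \<longleftrightarrow> b < a"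
      using no[of a b] no[of b a] by (auto intro!: swapE_less_iff[OF sp] simp: insert_commute)
    have "crosses (amap ?f y) (amap ?f x) \<longleftrightarrow> \<not> crosses x y"
      using a b ab f ff swapE_less_edge[OF sp, of p] j
      by (intro crosses_adjacent_swap[of x p a y b ?f]) (simp_all add: jp)
    moreover have "arr_at (amap ?f ` G) p = amap ?f y" "arr_at (amap ?f ` G) (Suc p) = amap ?f x"
      using arr_at_amap[OF cG inj_swapE[OF sp] P(2)] arr_at_amap[OF cG inj_swapE[OF sp] P(1)]
      by (simp_all add: f x_def y_def)
    ultimately show ?thesis by (simp add: eta_def jp x_def y_def)
  qed
  have pos: "1 \<le> j" if "j \<in> E" for j using swapE_edge(3)[OF sp that] by simp
  have "r3conf (amap ?f ` G) ((\<lambda>j. j) ` E)"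
    using pos swapE_edge(1,2)[OF sp]
    by (intro r3conf_transport[OF cG assms(2) order_refl inj_swapE[OF sp] wf_diag_swapE(1)[OF assms]
      _ _ _ mem(2,1) eta]) auto
  then show ?thesis by simp
qed

lemma r3_germ_flip:
  assumes "r3_germ g"
  shows "r3_germ (flip g)"
  using assms amap_swapE_involution[OF r3conf_sparse, of _ "gE g" "gG0 g"]
  by (auto simp: r3_germ_iff flip_def gkind_def gG0_def gG1_def gE_def r3conf_swap wf_diag_swapE)

lemma dist_r3conf:
  assumes "wf_diag G" "r3conf G E"
  shows "dist G E = (\<Union>j\<in>E. edge_arrows G j)" "card (dist G E) = 3"
proof -
  have cG: "chords G" by (rule wf_diag_imp_chords[OF assms(1)])
  have "p \<in> ends x \<longleftrightarrow> x = arr_at G p" if "p \<in> allends G" "x \<in> G" for p x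
    using arr_at[OF cG that(1)] arr_at_eq[OF cG that(2)] by blast
  moreover have "arr_at G p \<in> G" if "p \<in> allends G" for p using arr_at(1)[OF cG that] .
  ultimately show "dist G E = (\<Union>j\<in>E. edge_arrows G j)"
    unfolding dist_def edge_arrows_def using r3conf_allends[OF assms] by blast
  then show "card (dist G E) = 3" using assms(2) by (simp add: r3conf_def)
qed

text \<open>A surviving edge keeps two distinguished arrows. Together with at least two removed ones
  this would make four, but there are only three.\<close>

lemma r3conf_two_removed:
  assumes "wf_diag G" "r3conf G E" "\<not> card (X \<inter> dist G E) \<le> 1" "j \<in> E"
  shows "j - 1 \<notin> allends (G - X) \<or> j \<notin> allends (G - X)"
proof (rule ccontr)
  assume "\<not> ?thesis"
  then have *: "j - 1 \<in> allends (G - X)" "j \<in> allends (G - X)" by auto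
  have cG: "chords G" by (rule wf_diag_imp_chords[OF assms(1)])
  note cH = chords_subset[OF cG Diff_subset]
  have "arr_at G p \<in> G - X" if "p \<in> allends (G - X)" for p
    unfolding arr_at_subset[OF cG Diff_subset that] by (rule arr_at(1)[OF cH that])
  then have disj: "edge_arrows G j \<inter> (X \<inter> dist G E) = {}"
    using * unfolding edge_arrows_def by blast
  have two: "card (edge_arrows G j) = 2"
    using assms(2,4) unfolding edge_arrows_def r3conf_def two_arrow_edge_def by (metis card_2_iff)
  have fin: "finite (dist G E)" using dist_r3conf(2)[OF assms(1,2)] by (intro card_ge_0_finite) simp
  have sub: "edge_arrows G j \<subseteq> dist G E" using dist_r3conf(1)[OF assms(1,2)] assms(4) by blast
  have "card (edge_arrows G j \<union> (X \<inter> dist G E)) = 2 + card (X \<inter> dist G E)"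
    using card_Un_disjoint[OF finite_subset[OF sub fin] _ disj] fin two by simp
  moreover have "card (edge_arrows G j \<union> (X \<inter> dist G E)) \<le> card (dist G E)"
    using fin sub by (intro card_mono) auto
  ultimately show False using assms(3) dist_r3conf(2)[OF assms(1,2)] by simp
qed

section \<open>Subgerms of 3-germs\<close>

lemma germ_sel [simp]:
  "gkind (k, G0, G1, E) = k" "gG0 (k, G0, G1, E) = G0" "gG1 (k, G0, G1, E) = G1" "gE (k, G0, G1, E) = E"
  by (simp_all add: gkind_def gG0_def gG1_def gE_def)

lemma germ_eqI:
  "gkind g = gkind h \<Longrightarrow> gG0 g = gG0 h \<Longrightarrow> gG1 g = gG1 h \<Longrightarrow> gE g = gE h \<Longrightarrow> g = h"
  by (cases g; cases h) simp

lemma flip_sel [simp]: "gkind (flip g) = gkind g" "gG0 (flip g) = gG1 g" "gG1 (flip g) = gG0 g" "gE (flip g) = gE g"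
  by (simp_all add: flip_def)

lemma flip_flip [simp]: "flip (flip g) = g"
  by (rule germ_eqI) simp_all

lemma sub_sel:
  "gkind (sub g X) = (if gkind g = 3 \<and> X \<inter> dist (gG1 g) (gE g) \<noteq> {} then 4 else gkind g)"
  "gG0 (sub g X) = rem (gG0 g) (corr (gkind g) (gE g) (gG1 g) ` X)"
  "gG1 (sub g X) = rem (gG1 g) X"
  "gE (sub g X) = rank (allends (gG1 g - X)) ` both (gE g) (allends (gG1 g - X))"
  by (simp_all add: sub_def Let_def both_def)

lemma corr_12: "k = 1 \<or> k = 2 \<Longrightarrow> corr k E G = cmap G (dist G E)"
  and corr_34: "k \<noteq> 1 \<Longrightarrow> k \<noteq> 2 \<Longrightarrow> corr k E G = amap (swapE E)"
  by (auto simp: corr_def fun_eq_iff)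

lemma excl_12: "k = 1 \<or> k = 2 \<Longrightarrow> excl k E G = dist G E"
  and excl_34: "k \<noteq> 1 \<Longrightarrow> k \<noteq> 2 \<Longrightarrow> excl k E G = {}"
  by (auto simp: excl_def)

lemma dist_subset: "dist G E \<subseteq> G"
  by (auto simp: dist_def)

lemma both_full:
  assumes "chords G" "\<And>j. j \<in> E \<Longrightarrow> j \<in> allends G \<and> j - 1 \<in> allends G" "X \<inter> dist G E = {}"
  shows "both E (allends (G - X)) = E"
proof -
  have "p \<in> allends (G - X)" if "j \<in> E" "p = j \<or> p = j - 1" for j p
  proof -
    have "p \<in> allends G" using assms(2) that by blast
    then have p: "arr_at G p \<in> G" "p \<in> ends (arr_at G p)" using arr_at[OF assms(1)] by blast+
    then have "arr_at G p \<in> dist G E" using that unfolding dist_def by blast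
    then have "arr_at G p \<in> G - X" using p assms(3) by blast
    then show ?thesis using p ends_subset_allends by blast
  qed
  then show ?thesis unfolding both_def by blast
qed

text \<open>G0 is what the correspondence of arrows makes of G1 without the arrows born in an R1 or
  R2 move, so kind, G1 and edges determine the germ. \<open>sign_germ\<close> builds G0 by the same
  formula, which allows signed germs to be compared through G1 alone.\<close>

definition canonical :: "'s germ \<Rightarrow> bool" where
  "canonical h \<longleftrightarrow> gG0 h = corr (gkind h) (gE h) (gG1 h) ` (gG1 h - excl (gkind h) (gE h) (gG1 h))"

lemma r3_germD:
  assumes "r3_germ g"
  shows "gkind g = 3" "wf_diag (gG0 g)" "wf_diag (gG1 g)" "r3conf (gG0 g) (gE g)" "r3conf (gG1 g) (gE g)"
    "sparse (gE g)" "gG1 g = amap (swapE (gE g)) ` gG0 g" "gG0 g = amap (swapE (gE g)) ` gG1 g"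
proof -
  note g = iffD1[OF r3_germ_iff assms] and f = iffD1[OF r3_germ_iff r3_germ_flip[OF assms]]
  show "gkind g = 3" "wf_diag (gG0 g)" "r3conf (gG0 g) (gE g)" "gG1 g = amap (swapE (gE g)) ` gG0 g"
    using g by blast+
  show "wf_diag (gG1 g)" "r3conf (gG1 g) (gE g)" "gG0 g = amap (swapE (gE g)) ` gG1 g"
    using f unfolding flip_sel by blast+
  then show "sparse (gE g)" using r3conf_sparse by blast
qed

lemma r3_G0_Diff:
  assumes "r3_germ g" "X \<subseteq> gG1 g"
  shows "gG0 g - amap (swapE (gE g)) ` X = amap (swapE (gE g)) ` (gG1 g - X)"
  unfolding r3_germD(8)[OF assms(1)]
  using inj_on_image_set_diff[OF inj_on_amap[OF inj_swapE[OF r3_germD(6)[OF assms(1)]]] Diff_subset assms(2)]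
  by (rule sym)

lemma r3_sub_sel:
  assumes "r3_germ g" "X \<subseteq> gG1 g"
  defines "P \<equiv> allends (gG1 g - X)"
  shows "gkind (sub g X) = (if X \<inter> dist (gG1 g) (gE g) \<noteq> {} then 4 else 3)"
    "gG0 (sub g X) = rem (gG0 g) (amap (swapE (gE g)) ` X)"
    "gG0 (sub g X) = std (amap (swapE (gE g)) ` (gG1 g - X))"
    "gG1 (sub g X) = std (gG1 g - X)"
    "gE (sub g X) = rank P ` both (gE g) P"
    "gG0 (sub g X) = amap (swapE (gE (sub g X))) ` gG1 (sub g X)"
    "sparse (gE (sub g X))"
proof -
  note g = r3_germD[OF assms(1)]
  show "gkind (sub g X) = (if X \<inter> dist (gG1 g) (gE g) \<noteq> {} then 4 else 3)"
    by (simp add: sub_sel g(1))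
  show G0: "gG0 (sub g X) = rem (gG0 g) (amap (swapE (gE g)) ` X)"
    by (simp add: sub_sel corr_34 g(1))
  show G0': "gG0 (sub g X) = std (amap (swapE (gE g)) ` (gG1 g - X))"
    unfolding G0 rem_eq r3_G0_Diff[OF assms(1,2)] ..
  show G1: "gG1 (sub g X) = std (gG1 g - X)" by (simp add: sub_sel rem_eq)
  show E: "gE (sub g X) = rank P ` both (gE g) P" by (simp add: sub_sel P_def)
  show "gG0 (sub g X) = amap (swapE (gE (sub g X))) ` gG1 (sub g X)"
    unfolding G0' G1 E unfolding std_def allends_amap amap_image_image P_def[symmetric]
    by (rule amap_image_cong) (simp add: rank_swapE[OF g(6)] P_def)
  show "sparse (gE (sub g X))" unfolding E by (rule sparse_rank_image[OF g(6) refl])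
qed

lemma r3_sub_canonical:
  assumes "r3_germ g" "X \<subseteq> gG1 g"
  shows "canonical (sub g X)"
proof -
  have "gkind (sub g X) \<noteq> 1" "gkind (sub g X) \<noteq> 2"
    unfolding r3_sub_sel(1)[OF assms] by simp_all
  then show ?thesis
    unfolding canonical_def by (simp add: corr_34 excl_34 r3_sub_sel(6)[OF assms, symmetric])
qed

lemma r3_both_full:
  assumes "r3_germ g" "X \<inter> dist (gG1 g) (gE g) = {}"
  shows "both (gE g) (allends (gG1 g - X)) = gE g"
proof (rule both_full[OF wf_diag_imp_chords[OF r3_germD(3)[OF assms(1)]] _ assms(2)])
  show "j \<in> allends (gG1 g) \<and> j - 1 \<in> allends (gG1 g)" if "j \<in> gE g" for j
    using r3conf_allends[OF r3_germD(3,5)[OF assms(1)] that] by blast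
qed

lemma r3_sub:
  assumes "r3_germ g" "X \<subseteq> gG1 g" "X \<inter> dist (gG1 g) (gE g) = {}"
  shows "r3_germ (sub g X)"
proof -
  note g = r3_germD[OF assms(1)] and h = r3_sub_sel[OF assms(1,2)]
  let ?f = "swapE (gE g)" and ?P = "allends (gG1 g - X)"
  have both: "both (gE g) ?P = gE g" by (rule r3_both_full[OF assms(1,3)])
  \<comment> \<open>All distinguished edges survive with both ends, so the swap permutes the
    remaining positions and G0 and G1 are renumbered by the same rank function.\<close>
  have "?f ` ?P = ?P"
    using both by (intro swapE_image_full g(6)) (auto simp: both_def)
  then have P: "allends (gG0 g - amap ?f ` X) = ?P"
    unfolding r3_G0_Diff[OF assms(1,2)] by simp
  have "r3conf (rem (gG0 g) (amap ?f ` X)) (rank ?P ` gE g)"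
    using r3conf_rem[OF g(2,4), of "amap ?f ` X"] unfolding P by (simp add: both)
  moreover have "wf_diag (rem (gG0 g) (amap ?f ` X))"
    by (rule wf_diag_rem[OF wf_diag_imp_chords[OF g(2)]])
  moreover have "gE (sub g X) = rank ?P ` gE g" unfolding h(5) both ..
  moreover have "gG1 (sub g X) = amap (swapE (gE (sub g X))) ` gG0 (sub g X)"
    unfolding h(6) by (rule amap_swapE_involution[OF h(7), symmetric])
  ultimately show ?thesis
    unfolding r3_germ_iff using h(1,2) assms(3) by simp
qed

lemma dist_swapE:
  assumes "sparse E"
  shows "dist (amap (swapE E) ` G) E = amap (swapE E) ` dist G E"
proof -
  let ?Q = "\<lambda>P. \<exists>j\<in>E. j - 1 \<in> P \<or> j \<in> P"
  have "?Q (swapE E ` P) \<longleftrightarrow> ?Q P" for P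
    unfolding swapE_image_iff[OF assms] using swapE_edge[OF assms] by metis
  then have "?Q (ends (amap (swapE E) x)) \<longleftrightarrow> ?Q (ends x)" for x
    unfolding ends_amap by blast
  then show ?thesis unfolding dist_def by blast
qed

lemma r3_dist_G0:
  assumes "r3_germ g"
  shows "amap (swapE (gE g)) ` X \<inter> dist (gG0 g) (gE g) = amap (swapE (gE g)) ` (X \<inter> dist (gG1 g) (gE g))"
proof -
  note g = r3_germD[OF assms]
  have "dist (gG0 g) (gE g) = amap (swapE (gE g)) ` dist (gG1 g) (gE g)"
    using dist_swapE[OF g(6)] g(8) by metis
  moreover have "inj (amap (swapE (gE g)) :: bool arr \<Rightarrow> _)" by (rule inj_on_amap[OF inj_swapE[OF g(6)]])
  ultimately show ?thesis by (metis image_Int)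
qed

text \<open>\<open>sub\<close> is biased towards G1, to which the removed arrows and the edge
  numbers refer. Reversing the germ therefore replaces \<open>X\<close> by its counterparts in G0
  and relies on \<open>rank_both_swapE_image\<close> for the edges.\<close>

lemma r3_sub_flip:
  assumes "r3_germ g" "X \<subseteq> gG1 g"
  shows "flip (sub g X) = sub (flip g) (amap (swapE (gE g)) ` X)"
proof -
  let ?f = "swapE (gE g)"
  let ?X = "amap ?f ` X"
  note g = r3_germD[OF assms(1)] and h = r3_sub_sel[OF assms]
  have X: "?X \<subseteq> gG1 (flip g)" using assms(2) g(8) by auto
  note h' = r3_sub_sel[OF r3_germ_flip[OF assms(1)] X]
  note inv = amap_swapE_involution[OF g(6)]
  have P: "allends (gG1 (flip g) - ?X) = ?f ` allends (gG1 g - X)"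
    using r3_G0_Diff[OF assms] by simp
  note r3_dist_G0[OF assms(1), of X]
  then have "gkind (sub g X) = gkind (sub (flip g) ?X)" unfolding h(1) h'(1) by simp
  moreover have "gG1 (sub g X) = gG0 (sub (flip g) ?X)"
    unfolding h'(2) flip_sel inv by (simp add: sub_sel)
  moreover have "gG0 (sub g X) = gG1 (sub (flip g) ?X)"
    unfolding h(2) by (simp add: sub_sel)
  moreover have "gE (sub g X) = gE (sub (flip g) ?X)"
    unfolding h(5) h'(5) P using rank_both_swapE_image[OF g(6)] by simp
  ultimately show ?thesis by (intro germ_eqI) simp_all
qed

text \<open>A partial germ is by definition a 3-germ with one distinguished arrow removed and
  nothing else. So the removal is split: taking away the ordinary arrows \<open>Y\<close> leaves a
  3-germ, from which the renumbered copy \<open>c'\<close> of \<open>c\<close> is removed.\<close>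

lemma r3_sub_pgerm:
  assumes "r3_germ g" "X \<subseteq> gG1 g" "X \<inter> dist (gG1 g) (gE g) = {c}"
  shows "is_pgerm (sub g X)"
proof -
  define E Y f where "E = gE g" and "Y = X - {c}" and "f = swapE E"
  define P Q where "P = allends (gG1 g - X)" and "Q = allends (gG1 g - Y)"
  define c' where "c' = amap (rank Q) c"
  note g = r3_germD[OF assms(1), folded E_def]
  have c: "c \<in> X" "c \<in> dist (gG1 g) E" using assms(3) unfolding E_def by blast+
  have cY: "{c} \<subseteq> gG1 g - Y" using c(1) assms(2) by (auto simp: Y_def)
  have Y: "Y \<subseteq> gG1 g" "Y \<inter> dist (gG1 g) (gE g) = {}"
    using assms(2,3) unfolding Y_def by blast+
  note h = r3_sub[OF assms(1) Y] and hs = r3_sub_sel[OF assms(1) Y(1)]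
  have both: "both E Q = E" unfolding Q_def E_def by (rule r3_both_full[OF assms(1) Y(2)])
  have hE: "gE (sub g Y) = rank Q ` E" unfolding hs(5) using both by (simp add: Q_def E_def)
  have edge: "rank Q j - 1 = rank Q (j - 1)" "j \<in> Q" "j - 1 \<in> Q" if "j \<in> E" for j
  proof -
    have j: "j \<in> both E Q" unfolding both by (rule that)
    show "rank Q j - 1 = rank Q (j - 1)" unfolding rank_edge[OF g(6) j] by simp
    show "j \<in> Q" "j - 1 \<in> Q" using j unfolding both_def by blast+
  qed
  have PQ: "P \<subseteq> Q" unfolding P_def Q_def Y_def by (intro allends_mono) blast
  have XY: "gG1 g - X = gG1 g - Y - {c}" using c unfolding Y_def by blast
  have c'G: "c' \<in> gG1 (sub g Y)" unfolding c'_def hs(4) std_def Q_def using cY by blast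
  have c'D: "c' \<in> dist (gG1 (sub g Y)) (gE (sub g Y))"
  proof -
    obtain j where j: "j \<in> E" "j - 1 \<in> ends c \<or> j \<in> ends c" using c(2) unfolding dist_def by blast
    then have "rank Q j - 1 \<in> ends c' \<or> rank Q j \<in> ends c'"
      unfolding c'_def ends_amap edge(1)[OF j(1)] by blast
    then show ?thesis unfolding dist_def hE using c'G j(1) by blast
  qed
  have c'1: "{c'} \<subseteq> gG1 (sub g Y)" using c'G by simp
  note k = r3_sub_sel[OF h c'1] and l = r3_sub_sel[OF assms(1,2)]
  have H: "gG1 (sub g Y) - {c'} = amap (rank Q) ` (gG1 g - X)"
    unfolding hs(4) XY using std_image_Diff[OF cY] by (simp add: c'_def Q_def)
  have sm: "strict_mono_on P (rank Q)" by (rule monotone_on_subset[OF strict_mono_on_rank PQ])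
  have "gkind (sub g X) = gkind (sub (sub g Y) {c'})"
  proof -
    have "gkind (sub (sub g Y) {c'}) = 4"
      unfolding k(1) by (rule if_P) (use c'D in blast)
    moreover have "gkind (sub g X) = 4" unfolding l(1) by (rule if_P) (use assms(3) in blast)
    ultimately show ?thesis by simp
  qed
  moreover have "gG1 (sub g X) = gG1 (sub (sub g Y) {c'})"
    unfolding k(4) l(4) H by (rule std_amap[symmetric]) (use sm in \<open>simp add: P_def\<close>)
  moreover have E': "gE (sub g X) = gE (sub (sub g Y) {c'})"
  proof -
    have "rank Q j \<in> rank Q ` P \<longleftrightarrow> j \<in> P" "rank Q j - 1 \<in> rank Q ` P \<longleftrightarrow> j - 1 \<in> P" if "j \<in> E" for j
      unfolding edge(1)[OF that] using edge[OF that] inj_on_image_mem_iff[OF inj_on_rank _ PQ] by blast+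
    then have "both (rank Q ` E) (rank Q ` P) = rank Q ` both E P"
      unfolding both_def by blast
    then have "gE (sub (sub g Y) {c'}) = (\<lambda>j. rank (rank Q ` P) (rank Q j)) ` both E P"
      unfolding k(5) H hE by (simp add: P_def image_image)
    also have "\<dots> = rank P ` both E P"
      by (rule image_cong[OF refl], rule rank_image[OF sm]) (simp add: both_def)
    finally show ?thesis unfolding l(5) by (simp add: P_def E_def)
  qed
  \<comment> \<open>On both sides G0 is the swap of G1 along the edges, so agreement of G1 and of
    the edges is enough.\<close>
  moreover have "gG0 (sub g X) = gG0 (sub (sub g Y) {c'})"
    unfolding k(6) l(6) using calculation by simp
  ultimately have "sub g X = sub (sub g Y) {c'}" by (intro germ_eqI)
  then show ?thesis unfolding is_pgerm_def using h c'D by blast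
qed

definition genuine :: "bool germ \<Rightarrow> bool" where
  "genuine h \<longleftrightarrow> is_germ h \<or> is_pgerm h"

text \<open>The reversed subgerm matters because the antisymmetrised scalar product evaluates S
  there too. By \<open>r3_sub_flip\<close> it is a subgerm of the reversed germ.\<close>

lemma r3_sub_genuine:
  assumes "r3_germ g" "admissible g X"
  shows "genuine (sub g X)" "genuine (flip (sub g X))"
proof -
  have gen: "genuine (sub g X)" if g: "r3_germ g" "X \<subseteq> gG1 g" "card (X \<inter> dist (gG1 g) (gE g)) \<le> 1" for g X
  proof -
    have "finite (gG1 g)" using r3_germD(3)[OF g(1)] by (rule wf_diag_finite)
    then have "finite (X \<inter> dist (gG1 g) (gE g))"
      using finite_subset[OF dist_subset] by blast
    then consider "X \<inter> dist (gG1 g) (gE g) = {}" | c where "X \<inter> dist (gG1 g) (gE g) = {c}"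
      using g(3) card_0_eq card_1_singletonE by (metis One_nat_def le_SucE le_zero_eq)
    then show ?thesis
    proof cases
      case 1
      then show ?thesis using r3_sub[OF g(1,2)] by (simp add: genuine_def is_germ_def)
    next
      case 2
      then show ?thesis using r3_sub_pgerm[OF g(1,2)] by (simp add: genuine_def)
    qed
  qed
  note g = r3_germD[OF assms(1)]
  have X: "X \<subseteq> gG1 g" "card (X \<inter> dist (gG1 g) (gE g)) \<le> 1"
    using assms(2) g(1) by (simp_all add: admissible_def)
  show "genuine (sub g X)" by (rule gen[OF assms(1) X])
  let ?X = "amap (swapE (gE g)) ` X"
  have inj: "inj_on (amap (swapE (gE g))) (X \<inter> dist (gG1 g) (gE g))"
    by (rule inj_on_amap[OF inj_swapE[OF g(6)]])
  have "card (?X \<inter> dist (gG0 g) (gE g)) \<le> 1"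
    unfolding r3_dist_G0[OF assms(1)] card_image[OF inj] by (rule X(2))
  moreover have "?X \<subseteq> gG0 g" using X(1) g(8) by auto
  ultimately show "genuine (flip (sub g X))"
    unfolding r3_sub_flip[OF assms(1) X(1)] by (intro gen r3_germ_flip[OF assms(1)]) simp_all
qed

section \<open>Subgerms of 1-germs and 2-germs\<close>

lemma dist_eq:
  assumes "chords G" "D \<subseteq> G" "(\<Union>j\<in>E. {j - 1, j}) = allends D"
  shows "dist G E = D"
proof -
  have "x \<in> dist G E \<longleftrightarrow> x \<in> G \<and> (\<exists>p\<in>allends D. p \<in> ends x)" for x
    unfolding dist_def assms(3)[symmetric] by blast
  also have "\<dots> x \<longleftrightarrow> x \<in> D" for x
    using chords_unique[OF assms(1)] assms(2) atl_ends unfolding allends_def by blast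
  finally show ?thesis by blast
qed

lemma adjacent_max:
  fixes x y :: nat
  shows "x = Suc y \<or> y = Suc x \<Longrightarrow> {max x y - 1, max x y} = {x, y}"
  by (auto simp: max_def)

lemma r1_germE:
  assumes "r1_germ g"
  obtains a where "a \<in> gG1 g" "ahd a = Suc (atl a) \<or> atl a = Suc (ahd a)"
    "gE g = {max (atl a) (ahd a)}" "gG0 g = rem (gG1 g) {a}" "dist (gG1 g) (gE g) = {a}"
proof -
  obtain a where a: "a \<in> gG1 g" "ahd a = Suc (atl a) \<or> atl a = Suc (ahd a)"
    "gE g = {max (atl a) (ahd a)}" "gG0 g = rem (gG1 g) {a}" and wf: "wf_diag (gG1 g)"
    using assms unfolding r1_germ_def by blast
  have "(\<Union>j\<in>gE g. {j - 1, j}) = allends {a}"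
    using adjacent_max[of "atl a" "ahd a"] a(2,3) by (auto simp: allends_def ends_def)
  then have "dist (gG1 g) (gE g) = {a}"
    using a(1) by (intro dist_eq[OF wf_diag_imp_chords[OF wf]]) simp_all
  then show thesis by (rule that[OF a])
qed

lemma r2_germE:
  assumes "r2_germ g"
  obtains a b where "a \<in> gG1 g" "b \<in> gG1 g" "a \<noteq> b" "alab a \<noteq> alab b"
    "ahd a = Suc (ahd b) \<or> ahd b = Suc (ahd a)" "atl a = Suc (atl b) \<or> atl b = Suc (atl a)"
    "gE g = {max (ahd a) (ahd b), max (atl a) (atl b)}" "gG0 g = rem (gG1 g) {a, b}"
    "dist (gG1 g) (gE g) = {a, b}"
proof -
  obtain a b where ab: "a \<in> gG1 g" "b \<in> gG1 g" "a \<noteq> b" "alab a \<noteq> alab b"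
    "ahd a = Suc (ahd b) \<or> ahd b = Suc (ahd a)" "atl a = Suc (atl b) \<or> atl b = Suc (atl a)"
    "gE g = {max (ahd a) (ahd b), max (atl a) (atl b)}" "gG0 g = rem (gG1 g) {a, b}"
    and wf: "wf_diag (gG1 g)"
    using assms unfolding r2_germ_def by blast
  have "(\<Union>j\<in>gE g. {j - 1, j}) = {ahd a, ahd b} \<union> {atl a, atl b}"
    using adjacent_max[OF ab(5)] adjacent_max[OF ab(6)] unfolding ab(7) by simp
  also have "\<dots> = allends {a, b}" by (auto simp: allends_def ends_def)
  finally have "dist (gG1 g) (gE g) = {a, b}"
    using ab(1,2) by (intro dist_eq[OF wf_diag_imp_chords[OF wf]]) simp_all
  then show thesis by (rule that[OF ab])
qed

lemma r12_germD:
  assumes "r1_germ g \<or> r2_germ g"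
  shows "gkind g = 1 \<or> gkind g = 2" "wf_diag (gG1 g)" "gG0 g = rem (gG1 g) (dist (gG1 g) (gE g))"
    "(\<Union>j\<in>gE g. {j - 1, j}) \<subseteq> allends (gG1 g)"
proof -
  show "gkind g = 1 \<or> gkind g = 2" "wf_diag (gG1 g)"
    using assms unfolding r1_germ_def r2_germ_def by blast+
  have "gG0 g = rem (gG1 g) (dist (gG1 g) (gE g)) \<and> (\<Union>j\<in>gE g. {j - 1, j}) \<subseteq> allends (gG1 g)"
    using assms
  proof
    assume "r1_germ g"
    then show ?thesis
    proof (rule r1_germE)
      fix a assume a: "a \<in> gG1 g" "ahd a = Suc (atl a) \<or> atl a = Suc (ahd a)" "gE g = {max (atl a) (ahd a)}"
        "gG0 g = rem (gG1 g) {a}" "dist (gG1 g) (gE g) = {a}"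
      then have "(\<Union>j\<in>gE g. {j - 1, j}) = ends a"
        using adjacent_max[of "atl a" "ahd a"] by (auto simp: ends_def)
      then show ?thesis using ends_subset_allends[OF a(1)] a(4,5) by simp
    qed
  next
    assume "r2_germ g"
    then show ?thesis
    proof (rule r2_germE)
      fix a b assume ab: "a \<in> gG1 g" "b \<in> gG1 g"
        "ahd a = Suc (ahd b) \<or> ahd b = Suc (ahd a)" "atl a = Suc (atl b) \<or> atl b = Suc (atl a)"
        "gE g = {max (ahd a) (ahd b), max (atl a) (atl b)}"
        "gG0 g = rem (gG1 g) {a, b}" "dist (gG1 g) (gE g) = {a, b}"
      have "(\<Union>j\<in>gE g. {j - 1, j}) = {ahd a, ahd b} \<union> {atl a, atl b}"
        using adjacent_max[OF ab(3)] adjacent_max[OF ab(4)] unfolding ab(5) by simp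
      also have "\<dots> = ends a \<union> ends b" unfolding ends_def by blast
      finally show ?thesis
        using ends_subset_allends[OF ab(1)] ends_subset_allends[OF ab(2)] ab(6,7) by simp
    qed
  qed
  then show "gG0 g = rem (gG1 g) (dist (gG1 g) (gE g))"
    "(\<Union>j\<in>gE g. {j - 1, j}) \<subseteq> allends (gG1 g)" by blast+
qed

lemma mono_rank: "finite P \<Longrightarrow> mono (rank P)"
  unfolding rank_def by (intro monoI card_mono) auto

text \<open>By \<open>rem_rem\<close>, \<open>X\<close> and the distinguished arrows may be removed
  in either order. The removal that defines G0 can thus be performed last, as the definition of
  1-germs and 2-germs requires.\<close>

lemma r12_sub_sel:
  assumes "r1_germ g \<or> r2_germ g" "X \<subseteq> gG1 g" "X \<inter> dist (gG1 g) (gE g) = {}"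
  shows "gkind (sub g X) = gkind g" "gG1 (sub g X) = rem (gG1 g) X"
    "gG0 (sub g X) = rem (rem (gG1 g) X) (cmap (gG1 g) X ` dist (gG1 g) (gE g))"
    "gE (sub g X) = rank (allends (gG1 g - X)) ` gE g"
proof -
  note g = r12_germD[OF assms(1)]
  let ?D = "dist (gG1 g) (gE g)"
  show "gkind (sub g X) = gkind g" "gG1 (sub g X) = rem (gG1 g) X"
    using g(1) by (auto simp: sub_sel)
  have "X \<subseteq> gG1 g - ?D" "?D \<subseteq> gG1 g - X"
    using assms(2,3) dist_subset[of "gG1 g" "gE g"] by blast+
  note this[THEN rem_rem]
  then show "gG0 (sub g X) = rem (rem (gG1 g) X) (cmap (gG1 g) X ` ?D)"
    unfolding sub_sel corr_12[OF g(1)] g(3) by (simp add: Un_commute)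
  have "both (gE g) (allends (gG1 g - X)) = gE g"
    using g(4) by (intro both_full[OF wf_diag_imp_chords[OF g(2)] _ assms(3)]) blast
  then show "gE (sub g X) = rank (allends (gG1 g - X)) ` gE g" by (simp add: sub_sel)
qed

lemma r1_sub:
  assumes "r1_germ g" "X \<subseteq> gG1 g" "X \<inter> dist (gG1 g) (gE g) = {}"
  shows "r1_germ (sub g X)"
  using assms(1)
proof (rule r1_germE)
  fix a assume a: "a \<in> gG1 g" "ahd a = Suc (atl a) \<or> atl a = Suc (ahd a)"
    "gE g = {max (atl a) (ahd a)}" "dist (gG1 g) (gE g) = {a}"
  let ?P = "allends (gG1 g - X)" and ?a = "cmap (gG1 g) X a"
  note h = r12_sub_sel[OF disjI1[OF assms(1)] assms(2,3)]
  have wf: "wf_diag (gG1 g)" and k: "gkind g = 1" using assms(1) unfolding r1_germ_def by blast+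
  have aX: "a \<in> gG1 g - X" using a(1,4) assms(3) by blast
  have fin: "finite ?P" using wf by (intro finite_allends finite_Diff wf_diag_finite)
  have "atl a \<in> ?P" "ahd a \<in> ?P" using ends_subset_allends[OF aX] atl_ends ahd_ends by blast+
  then have "ahd ?a = Suc (atl ?a) \<or> atl ?a = Suc (ahd ?a)"
    using a(2) rank_Suc[of "atl a" ?P] rank_Suc[of "ahd a" ?P] by (auto simp: cmap_eq)
  moreover have "?a \<in> gG1 (sub g X)" unfolding h(2) rem_def using aX by (rule imageI)
  \<comment> \<open>An edge is numbered by its upper end, and the monotone \<open>rank\<close>
    commutes with this maximum.\<close>
  moreover have "gE (sub g X) = {max (atl ?a) (ahd ?a)}"
    unfolding h(4) a(3) by (simp add: cmap_eq max_of_mono[OF mono_rank[OF fin]])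
  moreover have "gG0 (sub g X) = rem (gG1 (sub g X)) {?a}"
    unfolding h(2,3) a(4) by simp
  moreover have "wf_diag (gG1 (sub g X))"
    unfolding h(2) by (rule wf_diag_rem[OF wf_diag_imp_chords[OF wf]])
  ultimately show ?thesis unfolding r1_germ_def h(1) using k by blast
qed

lemma r2_sub:
  assumes "r2_germ g" "X \<subseteq> gG1 g" "X \<inter> dist (gG1 g) (gE g) = {}"
  shows "r2_germ (sub g X)"
  using assms(1)
proof (rule r2_germE)
  fix a b assume ab: "a \<in> gG1 g" "b \<in> gG1 g" "a \<noteq> b" "alab a \<noteq> alab b"
    "ahd a = Suc (ahd b) \<or> ahd b = Suc (ahd a)" "atl a = Suc (atl b) \<or> atl b = Suc (atl a)"
    "gE g = {max (ahd a) (ahd b), max (atl a) (atl b)}" "dist (gG1 g) (gE g) = {a, b}"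
  let ?P = "allends (gG1 g - X)" and ?a = "cmap (gG1 g) X a" and ?b = "cmap (gG1 g) X b"
  note h = r12_sub_sel[OF disjI2[OF assms(1)] assms(2,3)]
  have wf: "wf_diag (gG1 g)" and k: "gkind g = 2" using assms(1) unfolding r2_germ_def by blast+
  have X: "a \<in> gG1 g - X" "b \<in> gG1 g - X" using ab(1,2,8) assms(3) by blast+
  have fin: "finite ?P" using wf by (intro finite_allends finite_Diff wf_diag_finite)
  have mem: "atl a \<in> ?P" "ahd a \<in> ?P" "atl b \<in> ?P" "ahd b \<in> ?P"
    using ends_subset_allends[OF X(1)] ends_subset_allends[OF X(2)] atl_ends ahd_ends by blast+
  have sel: "atl ?a = rank ?P (atl a)" "ahd ?a = rank ?P (ahd a)" "atl ?b = rank ?P (atl b)"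
    "ahd ?b = rank ?P (ahd b)" "alab ?a = alab a" "alab ?b = alab b"
    by (simp_all add: cmap_eq)
  have "ahd ?a = Suc (ahd ?b) \<or> ahd ?b = Suc (ahd ?a)"
    using ab(5) rank_Suc[OF mem(2)] rank_Suc[OF mem(4)] unfolding sel by metis
  moreover have "atl ?a = Suc (atl ?b) \<or> atl ?b = Suc (atl ?a)"
    using ab(6) rank_Suc[OF mem(1)] rank_Suc[OF mem(3)] unfolding sel by metis
  moreover have "?a \<in> gG1 (sub g X)" "?b \<in> gG1 (sub g X)" unfolding h(2) rem_def using X by blast+
  moreover have "alab ?a \<noteq> alab ?b" unfolding sel by (rule ab(4))
  moreover from this have "?a \<noteq> ?b" by metis
  moreover have "gE (sub g X) = {max (ahd ?a) (ahd ?b), max (atl ?a) (atl ?b)}"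
    unfolding h(4) ab(7) sel by (simp add: max_of_mono[OF mono_rank[OF fin]])
  moreover have "gG0 (sub g X) = rem (gG1 (sub g X)) {?a, ?b}"
    unfolding h(2,3) ab(8) by simp
  moreover have "wf_diag (gG1 (sub g X))"
    unfolding h(2) by (rule wf_diag_rem[OF wf_diag_imp_chords[OF wf]])
  ultimately show ?thesis unfolding r2_germ_def h(1) using k by blast
qed

section \<open>Germs and partial germs treated uniformly, and their signings\<close>

lemma is_pgermE:
  assumes "is_pgerm h"
  obtains g c where "r3_germ g" "{c} \<subseteq> gG1 g" "h = sub g {c}"
  using assms dist_subset unfolding is_pgerm_def by blast

lemma genuine_cases [consumes 1, case_names r12 r3 partial]:
  assumes "genuine h"
  obtains "r1_germ h \<or> r2_germ h" | "r3_germ h" | g c where "r3_germ g" "{c} \<subseteq> gG1 g" "h = sub g {c}"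
  using assms is_pgermE unfolding genuine_def is_germ_def by blast

text \<open>What the signing argument needs of germs of every kind. The bounds on edges and kind
  serve the finiteness of the support of dA.\<close>

lemma genuineD:
  assumes "genuine h"
  shows "canonical h" "wf_diag (gG1 h)" "wf_diag (gG0 h)" "gE h \<subseteq> allends (gG1 h)" "gkind h \<le> 4"
proof -
  have "canonical h \<and> wf_diag (gG1 h) \<and> wf_diag (gG0 h) \<and> gE h \<subseteq> allends (gG1 h) \<and> gkind h \<le> 4"
    using assms
  proof (cases rule: genuine_cases)
    case r12
    note g = r12_germD[OF r12]
    have "canonical h"
      unfolding canonical_def corr_12[OF g(1)] excl_12[OF g(1)] g(3)[unfolded rem_def] ..
    moreover have "wf_diag (gG0 h)"
      unfolding g(3) by (rule wf_diag_rem[OF wf_diag_imp_chords[OF g(2)]])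
    moreover have "gE h \<subseteq> allends (gG1 h)" using g(4) by blast
    ultimately show ?thesis using g(1,2) by auto
  next
    case r3
    note g = r3_germD[OF r3]
    have "gkind h \<noteq> 1" "gkind h \<noteq> 2" using g(1) by simp_all
    then have "canonical h"
      unfolding canonical_def by (simp add: corr_34 excl_34 g(8)[symmetric])
    moreover have "gE h \<subseteq> allends (gG1 h)" using r3conf_allends(1)[OF g(3,5)] by blast
    ultimately show ?thesis using g(1,2,3) by simp
  next
    case (partial g c)
    note s = r3_sub_sel[OF partial(1,2)] and g = r3_germD[OF partial(1)]
    let ?P = "allends (gG1 g - {c})"
    have "canonical h" unfolding partial(3) by (rule r3_sub_canonical[OF partial(1,2)])
    moreover have "wf_diag (gG1 h)"
      unfolding partial(3) sub_sel by (rule wf_diag_rem[OF wf_diag_imp_chords[OF g(3)]])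
    moreover have "wf_diag (gG0 h)"
      unfolding partial(3) sub_sel by (rule wf_diag_rem[OF wf_diag_imp_chords[OF g(2)]])
    moreover have "gE h \<subseteq> allends (gG1 h)"
      unfolding partial(3) s(4,5) std_def allends_amap both_def by blast
    moreover have "gkind h \<le> 4" unfolding partial(3) s(1) by simp
    ultimately show ?thesis by blast
  qed
  then show "canonical h" "wf_diag (gG1 h)" "wf_diag (gG0 h)" "gE h \<subseteq> allends (gG1 h)" "gkind h \<le> 4"
    by blast+
qed

lemma dist_forget:
  fixes G :: "gauss"
  shows "dist (forget G) E = forget (dist G E)"
proof -
  let ?Q = "\<lambda>P. \<exists>j\<in>E. j - 1 \<in> P \<or> j \<in> P"
  have "?Q (ends (setlab x ())) \<longleftrightarrow> ?Q (ends x)" for x :: "bool arr" by simp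
  then show ?thesis unfolding dist_def forget_def by blast
qed

lemma excl_forget: "excl k E (forget G) = forget (excl k E G)"
  unfolding excl_def by (simp add: dist_forget) (simp add: forget_def)

lemma forget_Diff:
  assumes "chords G" "D \<subseteq> G"
  shows "forget (G - D) = forget G - forget D"
  unfolding forget_def by (rule inj_on_image_set_diff[OF inj_on_forget[OF assms(1)] Diff_subset assms(2)])

text \<open>The correspondence of arrows is computed from positions, never from signs.\<close>

lemma corr_forget:
  assumes "chords G"
  shows "corr k E (forget G) (setlab x ()) = setlab (corr k E G x) ()"
proof -
  have "allends (forget G - dist (forget G) E) = allends (G - dist G E)"
    unfolding dist_forget forget_Diff[OF assms dist_subset, symmetric] by simp
  then show ?thesis unfolding corr_def cmap_eq by simp
qed

lemma forget_germ_sel [simp]: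
  "gkind (forget_germ h) = gkind h" "gG0 (forget_germ h) = forget (gG0 h)"
  "gG1 (forget_germ h) = forget (gG1 h)" "gE (forget_germ h) = gE h"
  by (simp_all add: forget_germ_def)

lemma excl_subset: "excl k E G \<subseteq> G"
  by (auto simp: excl_def dist_def)

lemma canonical_forget_germ:
  assumes "chords (gG1 h)" "canonical h"
  shows "canonical (forget_germ h)"
proof -
  let ?G = "gG1 h" and ?e = "excl (gkind h) (gE h) (gG1 h)" and ?c = "corr (gkind h) (gE h)"
  have "gG0 (forget_germ h) = forget (?c ?G ` (?G - ?e))"
    using assms(2) unfolding canonical_def by simp
  also have "\<dots> = (\<lambda>x. ?c (forget ?G) (setlab x ())) ` (?G - ?e)"
    unfolding forget_def image_image corr_forget[OF assms(1), unfolded forget_def] ..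
  also have "\<dots> = ?c (forget ?G) ` forget (?G - ?e)"
    unfolding forget_def image_image ..
  finally show ?thesis
    unfolding canonical_def by (simp add: excl_forget forget_Diff[OF assms(1) excl_subset])
qed

lemma alab_corr [simp]: "alab (corr k E G x) = alab x"
  by (simp add: corr_def cmap_eq)

text \<open>\<open>h\<close> is canonical and \<open>sign_germ\<close> transports signs along the
  same correspondence, so signs on G1 force those on G0. Together with \<open>signing_unique\<close>
  this leaves one signing of \<open>a\<close> that gives \<open>h\<close>.\<close>

lemma sign_germ_eq_iff:
  assumes "genuine h" "forget_germ h = a"
    and "\<tau> \<in> PiE (gG1 a) (\<lambda>_. UNIV)"
  shows "sign_germ a \<tau> = h \<longleftrightarrow> sign_diag (gG1 a) \<tau> = gG1 h"
proof
  show "sign_germ a \<tau> = h \<Longrightarrow> sign_diag (gG1 a) \<tau> = gG1 h" by (auto simp: sign_germ_def)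
next
  assume *: "sign_diag (gG1 a) \<tau> = gG1 h"
  let ?G = "gG1 h" and ?e = "excl (gkind h) (gE h) (gG1 h)" and ?c = "corr (gkind h) (gE h)"
  note h = genuineD[OF assms(1)]
  note chG = wf_diag_imp_chords[OF h(2)]
  have sel: "gG1 a = forget ?G" "gkind a = gkind h" "gE a = gE h" unfolding assms(2)[symmetric] by simp_all
  obtain \<sigma> where \<sigma>: "\<forall>x\<in>?G. \<sigma> (setlab x ()) = alab x"
    "\<forall>\<tau>\<in>PiE (gG1 a) (\<lambda>_. UNIV). sign_diag (gG1 a) \<tau> = ?G \<longleftrightarrow> \<tau> = \<sigma>"
    using signing_unique[OF chG sel(1)[symmetric]] by blast
  have \<tau>: "\<tau> = \<sigma>" using \<sigma>(2) assms(3) * by blast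
  have "gG0 (sign_germ a \<tau>) =
    (\<lambda>x. setlab (?c (forget ?G) x) (\<tau> x)) ` forget (?G - ?e)"
    by (simp add: sign_germ_def sel excl_forget forget_Diff[OF chG excl_subset])
  also have "\<dots> = (\<lambda>x. setlab (?c (forget ?G) (setlab x ())) (\<tau> (setlab x ()))) ` (?G - ?e)"
    unfolding forget_def image_image ..
  also have "\<dots> = ?c ?G ` (?G - ?e)"
  proof (rule image_cong[OF refl])
    fix x assume "x \<in> ?G - ?e"
    then have "\<tau> (setlab x ()) = alab (?c ?G x)" using \<sigma>(1) \<tau> by simp
    then show "setlab (?c (forget ?G) (setlab x ())) (\<tau> (setlab x ())) = ?c ?G x"
      unfolding corr_forget[OF chG] by (simp only: setlab_simps)
  qed
  also have "\<dots> = gG0 h" using h(1) unfolding canonical_def by simp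
  finally have "gG0 (sign_germ a \<tau>) = gG0 h" .
  moreover have "gkind (sign_germ a \<tau>) = gkind h" "gE (sign_germ a \<tau>) = gE h" "gG1 (sign_germ a \<tau>) = gG1 h"
    using * by (simp_all add: sign_germ_def sel)
  ultimately show "sign_germ a \<tau> = h" by (intro germ_eqI)
qed

lemma S_germ_eq:
  assumes "finite (gG1 a)"
  shows "S_germ a h = (if genuine h \<and> forget_germ h = a then sgnG (gG1 h) else 0)"
proof (cases "genuine h \<and> forget_germ h = a")
  case True
  note chG = wf_diag_imp_chords[OF genuineD(2)[OF conjunct1[OF True]]]
  have a: "forget (gG1 h) = gG1 a" using True by (metis forget_germ_sel(3))
  obtain \<sigma> where \<sigma>: "\<sigma> \<in> PiE (gG1 a) (\<lambda>_. UNIV)" "sgnprod (gG1 a) \<sigma> = sgnG (gG1 h)"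
    "\<forall>\<tau>\<in>PiE (gG1 a) (\<lambda>_. UNIV). sign_diag (gG1 a) \<tau> = gG1 h \<longleftrightarrow> \<tau> = \<sigma>"
    using signing_unique[OF chG a] by blast
  have "S_germ a h = (\<Sum>\<tau>\<in>PiE (gG1 a) (\<lambda>_. UNIV). if \<tau> = \<sigma> then sgnprod (gG1 a) \<sigma> else 0)"
    unfolding S_germ_def
  proof (rule sum.cong[OF refl])
    fix \<tau> assume \<tau>: "\<tau> \<in> PiE (gG1 a) (\<lambda>_. UNIV :: bool set)"
    then have "sign_germ a \<tau> = h \<longleftrightarrow> \<tau> = \<sigma>" using \<sigma>(3) True sign_germ_eq_iff by blast
    then have "(is_germ (sign_germ a \<tau>) \<or> is_pgerm (sign_germ a \<tau>)) \<and> forget_germ (sign_germ a \<tau>) = a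
        \<and> sign_germ a \<tau> = h \<longleftrightarrow> \<tau> = \<sigma>"
      using True unfolding genuine_def by metis
    then show "(if (is_germ (sign_germ a \<tau>) \<or> is_pgerm (sign_germ a \<tau>)) \<and> forget_germ (sign_germ a \<tau>) = a
        \<and> sign_germ a \<tau> = h then sgnprod (gG1 a) \<tau> else 0) = (if \<tau> = \<sigma> then sgnprod (gG1 a) \<sigma> else 0)"
      by simp
  qed
  also have "\<dots> = sgnG (gG1 h)" using \<sigma>(1,2) assms by (simp add: finite_PiE)
  finally show ?thesis using True by simp
next
  case False
  have "S_germ a h = 0"
    unfolding S_germ_def
  proof (rule sum.neutral, intro ballI if_not_P notI)
    fix \<tau> assume "(is_germ (sign_germ a \<tau>) \<or> is_pgerm (sign_germ a \<tau>)) \<and>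
      forget_germ (sign_germ a \<tau>) = a \<and> sign_germ a \<tau> = h"
    then show False using False unfolding genuine_def by metis
  qed
  then show ?thesis unfolding if_not_P[OF False] .
qed

lemma finite_supp_S_germ:
  assumes "finite (gG1 a)"
  shows "finite (supp (S_germ a))"
proof (rule finite_subset)
  show "supp (S_germ a) \<subseteq> sign_germ a ` PiE (gG1 a) (\<lambda>_. UNIV)"
  proof
    fix h assume "h \<in> supp (S_germ a)"
    then have "S_germ a h \<noteq> 0" by (simp add: supp_def)
    then obtain \<tau> where "\<tau> \<in> PiE (gG1 a) (\<lambda>_. UNIV)" "sign_germ a \<tau> = h"
      unfolding S_germ_def by (rule sum.not_neutral_contains_not_neutral) (metis (full_types))
    then show "h \<in> sign_germ a ` PiE (gG1 a) (\<lambda>_. UNIV)" by blast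
  qed
  show "finite (sign_germ a ` PiE (gG1 a) (\<lambda>_. UNIV :: bool set))"
    using assms by (simp add: finite_PiE)
qed

text \<open>G0 of a genuine germ is an image of part of G1, and forgetting signs preserves this;
  hence the bound on the number of arrows in \<open>d_basis\<close>.\<close>

lemma d_basis_nonzero_iff:
  assumes "finite A"
  shows "a \<in> supp (d_basis A) \<longleftrightarrow> (\<exists>h. genuine h \<and> forget_germ h = a \<and> forget (gG1 h) = A)"
proof -
  have "card (gG0 (forget_germ h)) \<le> card (gG1 (forget_germ h))" if "genuine h" "forget (gG1 h) = A" for h
  proof -
    note h = genuineD[OF that(1)]
    have can: "canonical (forget_germ h)"
      by (rule canonical_forget_germ[OF wf_diag_imp_chords[OF h(2)] h(1)])
    have fin: "finite (gG1 (forget_germ h))" using assms that(2) by simp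
    then show ?thesis
      unfolding can[unfolded canonical_def]
      by (meson Diff_subset card_image_le card_mono finite_Diff order_trans)
  qed
  moreover have "is_agerm a \<or> is_apgerm a \<longleftrightarrow> (\<exists>h. genuine h \<and> forget_germ h = a)"
    unfolding is_agerm_def is_apgerm_def genuine_def by blast
  moreover have "a \<in> supp (d_basis A) \<longleftrightarrow>
      (is_agerm a \<or> is_apgerm a) \<and> gG1 a = A \<and> card (gG0 a) \<le> card (gG1 a)"
    unfolding supp_def d_basis_def by auto
  ultimately show ?thesis using forget_germ_sel(3) by metis
qed

text \<open>Once G1 is \<open>A\<close>, the arrow germ is determined by its kind, at most 4, and
  its edges, a set of positions of ends of \<open>A\<close>. Finiteness matters because a sum over
  an infinite support would be 0 by convention.\<close>

lemma finite_supp_d_basis: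
  assumes "finite A"
  shows "finite (supp (d_basis A))"
proof (rule finite_subset)
  let ?m = "\<lambda>(k, E). (k, corr k E A ` (A - excl k E A), A, E)"
  show "supp (d_basis A) \<subseteq> ?m ` ({..4} \<times> Pow (allends A))"
  proof
    fix a assume "a \<in> supp (d_basis A)"
    then obtain h where h: "genuine h" "forget_germ h = a" "forget (gG1 h) = A"
      using d_basis_nonzero_iff[OF assms] by blast
    note g = genuineD[OF h(1)]
    have "canonical (forget_germ h)"
      by (rule canonical_forget_germ[OF wf_diag_imp_chords[OF g(2)] g(1)])
    then have "a = ?m (gkind h, gE h)"
      unfolding canonical_def using h(2,3) by (intro germ_eqI) auto
    moreover have "gE h \<subseteq> allends A" unfolding h(3)[symmetric] using g(4) by simp
    ultimately show "a \<in> ?m ` ({..4} \<times> Pow (allends A))" using g(5) by blast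
  qed
  show "finite (?m ` ({..4} \<times> Pow (allends A)))"
    using finite_allends[OF assms] by simp
qed

text \<open>A genuine \<open>h\<close> is a signed version of a single arrow germ,
  \<open>forget_germ h\<close>, which occurs in dA exactly when G1 of \<open>h\<close> becomes
  \<open>A\<close> without its signs. Thus pairing with dA evaluates \<open>val\<close> at second
  diagrams.\<close>

lemma sum_S_germ:
  assumes "finite A"
  shows "(\<Sum>a\<in>supp (d_basis A). S_germ a h) = (if genuine h then val A (gG1 h) else 0)"
proof -
  have fin: "finite (gG1 a)" if "a \<in> supp (d_basis A)" for a
    using that assms unfolding d_basis_nonzero_iff[OF assms] by auto
  have mem: "forget_germ h \<in> supp (d_basis A) \<longleftrightarrow> forget (gG1 h) = A" if "genuine h"
    using that unfolding d_basis_nonzero_iff[OF assms] by (metis forget_germ_sel(3))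
  have "(\<Sum>a\<in>supp (d_basis A). S_germ a h) =
    (\<Sum>a\<in>supp (d_basis A). if a = forget_germ h then (if genuine h then sgnG (gG1 h) else 0) else 0)"
    using S_germ_eq[OF fin] by (intro sum.cong refl) auto
  also have "\<dots> = (if forget_germ h \<in> supp (d_basis A) then (if genuine h then sgnG (gG1 h) else 0) else 0)"
    using finite_supp_d_basis[OF assms] by simp
  finally show ?thesis using mem by (simp add: val_def)
qed

section \<open>The pairing on germs\<close>

lemma finite_admissible: "finite (gG1 g) \<Longrightarrow> finite {X. admissible g X}"
  by (rule finite_subset[of _ "Pow (gG1 g)"]) (auto simp: admissible_def)

lemma I_germ_eq_0:
  assumes "h \<notin> sub g ` {X. admissible g X}"
  shows "I_germ g h = 0"
proof -
  have "{X. admissible g X \<and> sub g X = h} = {}" using assms by blast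
  then show ?thesis unfolding I_germ_def by (simp only: card.empty of_nat_0)
qed

lemma sum_I_germ:
  assumes "finite (gG1 g)"
  shows "(\<Sum>h\<in>sub g ` {X. admissible g X}. u h * I_germ g h) = (\<Sum>X | admissible g X. u (sub g X))"
  using sum_count_image[OF finite_admissible[OF assms], of u "sub g"] by (simp add: I_germ_def)

lemma ip_germ_12:
  assumes "finite (gG1 g)" "gkind g = 1 \<or> gkind g = 2"
  shows "ip_germ u (I_germ g) = (\<Sum>X | admissible g X. u (sub g X))"
proof -
  let ?T = "sub g ` {X. admissible g X}"
  have T: "gkind h = 1 \<or> gkind h = 2" if "h \<in> ?T" for h
  proof -
    obtain X where "h = sub g X" using \<open>h \<in> ?T\<close> by blast
    then have "gkind h = gkind g" using assms(2) by (auto simp: sub_sel(1))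
    then show ?thesis using assms(2) by simp
  qed
  have "I_germ g h = 0" if "gkind h \<in> {3, 4}" for h
    using T[of h] that by (intro I_germ_eq_0) auto
  then have "(\<Sum>h\<in>{h. gkind h \<in> {3, 4} \<and> (u h \<noteq> 0 \<or> I_germ g h \<noteq> 0 \<or> u (flip h) \<noteq> 0 \<or> I_germ g (flip h) \<noteq> 0)}.
      (u h - u (flip h)) * (I_germ g h - I_germ g (flip h))) = 0"
    by (intro sum.neutral) simp
  moreover have "(\<Sum>h\<in>{h \<in> supp u \<inter> supp (I_germ g). gkind h \<in> {1, 2}}. u h * I_germ g h) =
      (\<Sum>h\<in>?T. u h * I_germ g h)"
  proof (rule sum.mono_neutral_left)
    show "finite ?T" using finite_admissible[OF assms(1)] by blast
    show "{h \<in> supp u \<inter> supp (I_germ g). gkind h \<in> {1, 2}} \<subseteq> ?T"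
      using I_germ_eq_0 unfolding supp_def by blast
    show "\<forall>h\<in>?T - {h \<in> supp u \<inter> supp (I_germ g). gkind h \<in> {1, 2}}. u h * I_germ g h = 0"
    proof
      fix h assume h: "h \<in> ?T - {h \<in> supp u \<inter> supp (I_germ g). gkind h \<in> {1, 2}}"
      then have "gkind h \<in> {1, 2}" using T by blast
      then have "u h = 0 \<or> I_germ g h = 0" using h unfolding supp_def by blast
      then show "u h * I_germ g h = 0" by simp
    qed
  qed
  ultimately show ?thesis unfolding ip_germ_def sum_I_germ[OF assms(1)] by simp
qed

text \<open>By the relation (x,y) + (y,x) = 0 each subgerm \<open>h\<close> counts as
  \<open>h\<close> minus \<open>flip h\<close>. The antisymmetrised sum meets every such class both
  at \<open>h\<close> and at \<open>flip h\<close>, and the factor 1/2 removes the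
  repetition.\<close>

lemma ip_germ_3:
  assumes "finite (gG1 g)" "gkind g = 3" "finite (supp u)"
  shows "ip_germ u (I_germ g) = (\<Sum>X | admissible g X. u (sub g X) - u (flip (sub g X)))"
proof -
  let ?T = "sub g ` {X. admissible g X}" and ?v = "I_germ g"
  let ?K = "{h. gkind h \<in> {3, 4} \<and> (u h \<noteq> 0 \<or> ?v h \<noteq> 0 \<or> u (flip h) \<noteq> 0 \<or> ?v (flip h) \<noteq> 0)}"
  define U where "U = ?T \<union> flip ` ?T"
  have finT: "finite ?T" using finite_admissible[OF assms(1)] by blast
  then have finU: "finite U" by (simp add: U_def)
  have T: "gkind h \<in> {3, 4}" if "h \<in> ?T" for h
  proof -
    obtain X where "h = sub g X" using \<open>h \<in> ?T\<close> by blast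
    then show ?thesis using assms(2) by (simp add: sub_sel(1))
  qed
  have U: "gkind h \<in> {3, 4}" if "h \<in> U" for h
    using that T unfolding U_def by fastforce
  have v: "?v h = 0" if "h \<notin> ?T" for h using that by (rule I_germ_eq_0)
  have vflip: "?v (flip h) = 0" if "h \<notin> U" for h
    using that unfolding U_def by (intro v) (metis UnI2 flip_flip image_eqI)
  have flipU: "flip ` U = U"
    unfolding U_def by (simp add: image_Un image_image Un_commute)
  have inj: "inj_on flip U" by (metis flip_flip inj_on_inverseI)
  let ?s = "\<lambda>h. (u h - u (flip h)) * (?v h - ?v (flip h))"
  \<comment> \<open>Sums over infinite sets are 0 by convention, so the index set, which also
    involves the support of \<open>u\<close> and its reversal, has to be finite.\<close>
  have finK: "finite ?K"
  proof (rule finite_subset)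
    show "?K \<subseteq> supp u \<union> flip ` supp u \<union> U"
    proof
      fix h assume h: "h \<in> ?K"
      show "h \<in> supp u \<union> flip ` supp u \<union> U"
      proof (rule ccontr)
        assume n: "h \<notin> supp u \<union> flip ` supp u \<union> U"
        then have "u h = 0" "?v h = 0" "?v (flip h) = 0"
          using v vflip unfolding U_def supp_def by blast+
        moreover have "u (flip h) = 0"
        proof (rule ccontr)
          assume "u (flip h) \<noteq> 0"
          then have "flip (flip h) \<in> flip ` supp u" unfolding supp_def by blast
          then show False using n by simp
        qed
        ultimately show False using h by blast
      qed
    qed
    show "finite (supp u \<union> flip ` supp u \<union> U)" using assms(3) finU by blast
  qed
  have "sum ?s ?K = sum ?s (?K \<union> U)"
    using finK finU U by (intro sum.mono_neutral_left) auto
  also have "\<dots> = sum ?s U"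
  proof (rule sum.mono_neutral_right)
    show "\<forall>h\<in>?K \<union> U - U. ?s h = 0" using v vflip unfolding U_def by auto
  qed (use finK finU in auto)
  also have "\<dots> = (\<Sum>h\<in>U. (u h - u (flip h)) * ?v h) - (\<Sum>h\<in>U. (u h - u (flip h)) * ?v (flip h))"
    by (simp add: right_diff_distrib sum_subtractf)
  \<comment> \<open>Substituting \<open>flip h\<close> for \<open>h\<close> on the invariant set
    \<open>U\<close> shows that the subtracted sum is minus the other one, whence the factor
    2.\<close>
  also have "(\<Sum>h\<in>U. (u h - u (flip h)) * ?v (flip h)) = (\<Sum>h\<in>flip ` U. (u (flip h) - u h) * ?v h)"
    by (subst sum.reindex[OF inj]) simp
  also have "\<dots> = - (\<Sum>h\<in>U. (u h - u (flip h)) * ?v h)"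
    unfolding flipU sum_negf[symmetric] by (intro sum.cong refl) (simp add: left_diff_distrib)
  also have "(\<Sum>h\<in>U. (u h - u (flip h)) * ?v h) = (\<Sum>h\<in>?T. (u h - u (flip h)) * ?v h)"
    using finU v by (intro sum.mono_neutral_right) (auto simp: U_def)
  also have "\<dots> = (\<Sum>X | admissible g X. u (sub g X) - u (flip (sub g X)))"
    by (rule sum_I_germ[OF assms(1)])
  finally have K: "sum ?s ?K = 2 * (\<Sum>X | admissible g X. u (sub g X) - u (flip (sub g X)))"
    by simp
  have "gkind h \<noteq> 1 \<and> gkind h \<noteq> 2" if "h \<in> supp ?v" for h
  proof -
    have "h \<in> ?T" using v that unfolding supp_def by blast
    from T[OF this] show ?thesis by auto
  qed
  then have "(\<Sum>h\<in>{h \<in> supp u \<inter> supp ?v. gkind h \<in> {1, 2}}. u h * ?v h) = 0"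
    by (intro sum.neutral) blast
  then show ?thesis unfolding ip_germ_def K by simp
qed

section \<open>Sums over all subdiagrams of the two diagrams of a germ\<close>

lemma sum_Pow_insert:
  assumes "finite H" "a \<notin> H"
  shows "(\<Sum>X\<in>Pow (insert a H). F X) = (\<Sum>X\<in>Pow H. F X) + (\<Sum>X\<in>Pow H. F (insert a X))"
proof -
  have inj: "inj_on (insert a) (Pow H)" using assms(2) by (auto simp: inj_on_def)
  have "(\<Sum>X\<in>Pow (insert a H). F X) = (\<Sum>X\<in>Pow H. F X) + (\<Sum>X\<in>insert a ` Pow H. F X)"
    unfolding Pow_insert using assms by (intro sum.union_disjoint) auto
  then show ?thesis by (simp add: sum.reindex[OF inj])
qed

text \<open>Subsets of \<open>rem G D\<close> are renumbered subsets \<open>Z\<close> of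
  \<open>G - D\<close>, and removing \<open>Z\<close> after \<open>D\<close> is removing both. For
  R1 and R2 this finds the subdiagrams of G0 among those of G1.\<close>

lemma sum_Pow_rem:
  assumes "D \<subseteq> G"
  shows "(\<Sum>Y\<in>Pow (rem G D). F (rem (rem G D) Y)) = (\<Sum>Z\<in>Pow (G - D). F (rem G (D \<union> Z)))"
proof -
  have inj: "inj_on (cmap G D) (G - D)" unfolding cmap_eq by (rule inj_on_std)
  have "Pow (rem G D) = image (cmap G D) ` Pow (G - D)" unfolding rem_def by (rule image_Pow_surj[OF refl, symmetric])
  then have "(\<Sum>Y\<in>Pow (rem G D). F (rem (rem G D) Y)) =
      (\<Sum>Z\<in>Pow (G - D). F (rem (rem G D) (cmap G D ` Z)))"
    by (simp add: sum.reindex[OF inj_on_image_Pow[OF inj]])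
  also have "\<dots> = (\<Sum>Z\<in>Pow (G - D). F (rem G (D \<union> Z)))"
    by (intro sum.cong refl) (simp add: rem_rem)
  finally show ?thesis .
qed

text \<open>With one arrow of an R2 pair removed, the swap of the two adjacent ends carries one
  remaining arrow to the other, up to the sign.\<close>

lemma val_r2_cancel:
  assumes G: "chords G" "a \<in> G" "b \<in> G" "a \<noteq> b" "alab a \<noteq> alab b"
    and adj: "ahd a = Suc (ahd b) \<or> ahd b = Suc (ahd a)" "atl a = Suc (atl b) \<or> atl b = Suc (atl a)"
    and Z: "Z \<subseteq> G - {a, b}"
  shows "val A (rem G (insert a Z)) = - val A (rem G (insert b Z))"
proof -
  define m n where "m = max (ahd a) (ahd b)" and "n = max (atl a) (atl b)"
  define E where "E = {m, n}"
  define H where "H = G - {a, b} - Z"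
  \<comment> \<open>Relabelling positions keeps signs, so the swap carries to \<open>b\<close> not
    \<open>a\<close> itself but \<open>a\<close> with the sign of \<open>b\<close>. This change of
    sign is the origin of the minus sign.\<close>
  define a' where "a' = setlab a (alab b)"
  have m: "{m - 1, m} = {ahd a, ahd b}" "m \<noteq> 0" and n: "{n - 1, n} = {atl a, atl b}" "n \<noteq> 0"
    using adjacent_max[OF adj(1)] adjacent_max[OF adj(2)] adj by (auto simp: m_def n_def max_def)
  have disj: "ends a \<inter> ends b = {}" "atl a \<noteq> ahd a" "atl b \<noteq> ahd b"
    using G unfolding chords_def by blast+
  then have mn: "{m - 1, m} \<inter> {n - 1, n} = {}"
    unfolding m n by (auto simp: ends_def)
  have sp: "sparse E"
    using mn m(2) n(2) by (auto simp: sparse_def E_def)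
  have f: "swapE E (ahd a) = ahd b" "swapE E (atl a) = atl b"
    using swapE_edge[OF sp, of m] swapE_edge[OF sp, of n] adj
    by (auto simp: E_def m_def n_def max_def split: if_splits)
  have HG: "H \<subseteq> G" "a \<notin> H" "b \<notin> H" by (auto simp: H_def)
  have disjH: "ends x \<inter> allends H = {}" if "x \<in> {a, b}" for x
  proof -
    have x: "x \<in> G" "x \<notin> H" using that G(2,3) HG(2,3) by blast+
    have "p \<notin> allends H" if "p \<in> ends x" for p
      using allends_Int_chords[OF G(1) x(1) that HG(1)] x(2) by simp
    then show ?thesis by blast
  qed
  have aH: "allends (insert a' H) = ends a \<union> allends H" by (simp add: allends_insert a'_def)
  have notin: "{ahd b, atl b} \<inter> allends (insert a' H) = {}"
    using disjH[of b] disj(1) unfolding aH by (auto simp: ends_def)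
  \<comment> \<open>Each of the two edges has one end on \<open>b\<close>, which is absent
    here.\<close>
  have "strict_mono_on (allends (insert a' H)) (swapE E)"
  proof (rule swapE_strict_mono_on[OF sp])
    fix j assume "j \<in> E"
    then have "ahd b \<in> {j - 1, j} \<or> atl b \<in> {j - 1, j}" using m(1) n(1) unfolding E_def by blast
    moreover have "ahd b \<notin> allends (insert a' H)" "atl b \<notin> allends (insert a' H)"
      using notin by simp_all
    ultimately show "j - 1 \<notin> allends (insert a' H) \<or> j \<notin> allends (insert a' H)"
      by (metis empty_iff insert_iff)
  qed
  note std_amap[OF this]
  moreover have "amap (swapE E) ` insert a' H = insert b H"
  proof -
    have "amap (swapE E) a' = b" by (simp add: arr_eq_iff a'_def f)
    moreover have "amap (swapE E) ` H = H"
    proof (rule amap_image_ident, rule swapE_fixed)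
      fix p assume p: "p \<in> allends H"
      have "p \<notin> {ahd a, ahd b} \<union> {atl a, atl b}"
        using disjH[of a] disjH[of b] p by (auto simp: ends_def)
      then have "p \<notin> {m - 1, m} \<union> {n - 1, n}" unfolding m n .
      then show "p \<notin> E" "Suc p \<notin> E" unfolding E_def by auto
    qed
    ultimately show ?thesis by simp
  qed
  ultimately have std: "std (insert b H) = std (insert a' H)" by simp
  have a'H: "a' \<notin> H"
    using disjH[of a] ends_subset_allends[of a' H] by (auto simp: a'_def ends_def)
  have fin: "finite H" using chords_finite[OF G(1)] HG(1) by (rule finite_subset[rotated])
  have "sgnG (insert a' H) = - sgnG (insert a H)"
    using fin a'H HG(2) G(5) unfolding sgnG_def by (simp add: a'_def)
  moreover have "forget (insert a' H) = forget (insert a H)" by (simp add: a'_def)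
  ultimately have "val A (std (insert a' H)) = - val A (std (insert a H))"
    unfolding val_def sgnG_std forget_std by simp
  moreover have "G - insert b Z = insert a H" "G - insert a Z = insert b H"
    using G Z unfolding H_def by blast+
  ultimately show ?thesis unfolding rem_eq using std by simp
qed

lemma sum_val_r12:
  assumes "r1_germ g \<or> r2_germ g"
  shows "(\<Sum>X | admissible g X. val A (rem (gG1 g) X)) =
    (\<Sum>X\<in>Pow (gG1 g). val A (rem (gG1 g) X)) - (\<Sum>X\<in>Pow (gG0 g). val A (rem (gG0 g) X))"
proof -
  let ?G = "gG1 g" and ?D = "dist (gG1 g) (gE g)"
  let ?F = "\<lambda>X. val A (rem ?G X)"
  note g = r12_germD[OF assms]
  note chG = wf_diag_imp_chords[OF g(2)] and finG = wf_diag_finite[OF g(2)]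
  have adm: "{X. admissible g X} = Pow (?G - ?D)"
    using g(1) unfolding admissible_def by auto
  have G0: "(\<Sum>X\<in>Pow (gG0 g). val A (rem (gG0 g) X)) = (\<Sum>Z\<in>Pow (?G - ?D). ?F (?D \<union> Z))"
    unfolding g(3) by (rule sum_Pow_rem[OF dist_subset])
  have "(\<Sum>X\<in>Pow ?G. ?F X) = (\<Sum>X\<in>Pow (?G - ?D). ?F X) + (\<Sum>Z\<in>Pow (?G - ?D). ?F (?D \<union> Z))"
    using assms
  proof
    assume "r1_germ g"
    then show ?thesis
    proof (rule r1_germE)
      fix a assume a: "a \<in> ?G" "?D = {a}"
      have G: "?G = insert a (?G - ?D)" using a by blast
      show ?thesis
        unfolding arg_cong[OF G, of "\<lambda>G. \<Sum>X\<in>Pow G. ?F X"]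
        using a finG by (subst sum_Pow_insert) simp_all
    qed
  next
    assume "r2_germ g"
    then show ?thesis
    proof (rule r2_germE)
      fix a b assume ab: "a \<in> ?G" "b \<in> ?G" "a \<noteq> b" "alab a \<noteq> alab b"
        "ahd a = Suc (ahd b) \<or> ahd b = Suc (ahd a)" "atl a = Suc (atl b) \<or> atl b = Suc (atl a)"
        "?D = {a, b}"
      let ?H = "?G - ?D"
      have G: "?G = insert a (insert b ?H)" using ab by blast
      have H: "finite ?H" "b \<notin> ?H" "a \<notin> insert b ?H" using ab finG by auto
      have "(\<Sum>Z\<in>Pow ?H. ?F (insert a Z)) = (\<Sum>Z\<in>Pow ?H. - ?F (insert b Z))"
        using val_r2_cancel[OF chG ab(1-6)] by (intro sum.cong refl) (simp add: ab(7))
      then have "(\<Sum>Z\<in>Pow ?H. ?F (insert a Z)) = - (\<Sum>Z\<in>Pow ?H. ?F (insert b Z))"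
        by (simp add: sum_negf)
      then show ?thesis
        unfolding arg_cong[OF G, of "\<lambda>G. \<Sum>X\<in>Pow G. ?F X"]
          sum_Pow_insert[OF finite.insertI[OF H(1)] H(3)] sum_Pow_insert[OF H(1,2)]
        by (simp add: ab(7))
    qed
  qed
  then show ?thesis unfolding adm G0 by simp
qed

text \<open>The swap matches the removed sets of G1 with those of G0, so the difference is one sum
  over \<open>X\<close>. Unlike for R2, where non-admissible terms cancel in pairs, here each of
  them vanishes by itself.\<close>

lemma sum_val_r3:
  assumes "r3_germ g"
  shows "(\<Sum>X | admissible g X. val A (gG1 (sub g X)) - val A (gG0 (sub g X))) =
    (\<Sum>X\<in>Pow (gG1 g). val A (rem (gG1 g) X)) - (\<Sum>X\<in>Pow (gG0 g). val A (rem (gG0 g) X))"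
proof -
  let ?f = "amap (swapE (gE g))" and ?G = "gG1 g"
  let ?s = "\<lambda>X. val A (rem ?G X) - val A (rem (gG0 g) (?f ` X))"
  note g = r3_germD[OF assms]
  have inj: "inj_on ?f ?G" by (rule inj_on_amap[OF inj_swapE[OF g(6)]])
  have fin: "finite ?G" by (rule wf_diag_finite[OF g(3)])
  have adm: "admissible g X \<longleftrightarrow> X \<subseteq> ?G \<and> card (X \<inter> dist ?G (gE g)) \<le> 1" for X
    using g(1) by (simp add: admissible_def)
  have Pow: "Pow (gG0 g) = image ?f ` Pow ?G"
    unfolding g(8) by (rule image_Pow_surj[OF refl, symmetric])
  have "(\<Sum>X\<in>Pow ?G. val A (rem ?G X)) - (\<Sum>X\<in>Pow (gG0 g). val A (rem (gG0 g) X)) = sum ?s (Pow ?G)"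
    unfolding Pow by (simp add: sum.reindex[OF inj_on_image_Pow[OF inj]] sum_subtractf)
  also have "\<dots> = sum ?s {X. admissible g X}"
  proof (rule sum.mono_neutral_right)
    show "finite (Pow ?G)" using fin by simp
    show "{X. admissible g X} \<subseteq> Pow ?G" using adm by blast
    show "\<forall>X\<in>Pow ?G - {X. admissible g X}. ?s X = 0"
    proof
      fix X assume "X \<in> Pow ?G - {X. admissible g X}"
      then have X: "X \<subseteq> ?G" "\<not> card (X \<inter> dist ?G (gE g)) \<le> 1" using adm by blast+
      have "strict_mono_on (allends (?G - X)) (swapE (gE g))"
        using r3conf_two_removed[OF g(3,5) X(2)] by (intro swapE_strict_mono_on[OF g(6)])
      then have "rem (gG0 g) (?f ` X) = rem ?G X"
        unfolding rem_eq r3_G0_Diff[OF assms X(1)] by (rule std_amap)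
      then show "?s X = 0" by simp
    qed
  qed
  also have "\<dots> = (\<Sum>X | admissible g X. val A (gG1 (sub g X)) - val A (gG0 (sub g X)))"
    using adm r3_sub_sel(2)[OF assms] by (intro sum.cong refl) (simp add: sub_sel(3))
  finally show ?thesis ..
qed

text \<open>The adjunction for one diagram and one germ. For R1 and R2 the sum over subgerms sees
  only G1, and \<open>sum_val_r12\<close> supplies the G0 term; for R3 the G0 term is already
  present as the \<open>flip\<close> part of the scalar product.\<close>

lemma pairing_germ:
  assumes "is_germ g" "finite A"
  shows "(\<Sum>a\<in>supp (d_basis A). ip_germ (S_germ a) (I_germ g)) =
    ip_diag (S_diag A) (I_diag (gG1 g)) - ip_diag (S_diag A) (I_diag (gG0 g))"
proof -
  have gen: "genuine g" using assms(1) by (simp add: genuine_def)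
  note wf = genuineD(2,3)[OF gen]
  have fin: "finite (gG1 g)" by (rule wf_diag_finite[OF wf(1)])
  have finA: "finite (gG1 a)" if "a \<in> supp (d_basis A)" for a
    using that assms(2) unfolding d_basis_nonzero_iff[OF assms(2)] by auto
  consider (r12) "r1_germ g \<or> r2_germ g" | (r3) "r3_germ g" using assms(1) unfolding is_germ_def by blast
  then have "(\<Sum>a\<in>supp (d_basis A). ip_germ (S_germ a) (I_germ g)) =
    (\<Sum>X\<in>Pow (gG1 g). val A (rem (gG1 g) X)) - (\<Sum>X\<in>Pow (gG0 g). val A (rem (gG0 g) X))"
  proof cases
    case r12
    have "(\<Sum>a\<in>supp (d_basis A). ip_germ (S_germ a) (I_germ g)) =
        (\<Sum>X | admissible g X. \<Sum>a\<in>supp (d_basis A). S_germ a (sub g X))"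
      unfolding ip_germ_12[OF fin r12_germD(1)[OF r12]] by (rule sum.swap)
    also have "\<dots> = (\<Sum>X | admissible g X. val A (rem (gG1 g) X))"
    proof (rule sum.cong[OF refl])
      fix X assume "X \<in> {X. admissible g X}"
      then have X: "X \<subseteq> gG1 g" "X \<inter> dist (gG1 g) (gE g) = {}"
        using r12_germD(1)[OF r12] unfolding admissible_def by auto
      then have "genuine (sub g X)"
        using r12 r1_sub r2_sub unfolding genuine_def is_germ_def by blast
      then show "(\<Sum>a\<in>supp (d_basis A). S_germ a (sub g X)) = val A (rem (gG1 g) X)"
        unfolding sum_S_germ[OF assms(2)] by (simp add: sub_sel(3))
    qed
    finally show ?thesis unfolding sum_val_r12[OF r12] .
  next
    case r3
    have "(\<Sum>a\<in>supp (d_basis A). ip_germ (S_germ a) (I_germ g)) =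
        (\<Sum>a\<in>supp (d_basis A). \<Sum>X | admissible g X. S_germ a (sub g X) - S_germ a (flip (sub g X)))"
      using ip_germ_3[OF fin r3_germD(1)[OF r3] finite_supp_S_germ] finA by (intro sum.cong refl) blast
    also have "\<dots> = (\<Sum>X | admissible g X. \<Sum>a\<in>supp (d_basis A). S_germ a (sub g X) - S_germ a (flip (sub g X)))"
      by (rule sum.swap)
    also have "\<dots> = (\<Sum>X | admissible g X. val A (gG1 (sub g X)) - val A (gG0 (sub g X)))"
      using r3_sub_genuine[OF r3]
      by (intro sum.cong refl) (simp add: sum_subtractf sum_S_germ[OF assms(2)])
    finally show ?thesis unfolding sum_val_r3[OF r3] .
  qed
  then show ?thesis
    unfolding ip_diag_eq[OF wf(1) assms(2)] ip_diag_eq[OF wf(2) assms(2)] .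
qed

section \<open>Bilinear extension\<close>

lemma pairD_bd:
  assumes "finite (supp \<gamma>)"
  shows "pairD \<A> (bd \<gamma>) = (\<Sum>A\<in>supp \<A>. \<A> A * (\<Sum>g\<in>supp \<gamma>. \<gamma> g *
    (ip_diag (S_diag A) (I_diag (gG1 g)) - ip_diag (S_diag A) (I_diag (gG0 g)))))"
  unfolding pairD_def
proof (rule sum.cong[OF refl])
  fix A
  let ?c = "\<lambda>G. ip_diag (S_diag A) (I_diag G)"
  \<comment> \<open>Different germs may share diagrams, whose coefficients in
    \<open>bd \<gamma>\<close> can cancel. Summing over all diagrams that occur gives an index set
    independent of such cancellation.\<close>
  define U where "U = gG1 ` supp \<gamma> \<union> gG0 ` supp \<gamma>"
  have finU: "finite U" using assms by (simp add: U_def)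
  have "supp (bd \<gamma>) \<subseteq> U"
  proof
    fix G assume "G \<in> supp (bd \<gamma>)"
    then have "bd \<gamma> G \<noteq> 0" by (simp add: supp_def)
    then obtain g where "g \<in> supp \<gamma>"
      "\<gamma> g * ((if gG1 g = G then 1 else 0) - (if gG0 g = G then 1 else 0)) \<noteq> 0"
      unfolding bd_def by (rule sum.not_neutral_contains_not_neutral)
    then show "G \<in> U" unfolding U_def by (cases "gG1 g = G"; cases "gG0 g = G") auto
  qed
  then have "(\<Sum>G\<in>supp (bd \<gamma>). \<A> A * bd \<gamma> G * ?c G) = (\<Sum>G\<in>U. \<A> A * bd \<gamma> G * ?c G)"
    using finU by (intro sum.mono_neutral_left) (auto simp: supp_def)
  also have "\<dots> = (\<Sum>G\<in>U. \<Sum>g\<in>supp \<gamma>.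
      \<A> A * (\<gamma> g * ((if gG1 g = G then ?c G else 0) - (if gG0 g = G then ?c G else 0))))"
    unfolding bd_def sum_distrib_left sum_distrib_right by (intro sum.cong refl) auto
  also have "\<dots> = (\<Sum>g\<in>supp \<gamma>. \<Sum>G\<in>U.
      \<A> A * (\<gamma> g * ((if gG1 g = G then ?c G else 0) - (if gG0 g = G then ?c G else 0))))"
    by (rule sum.swap)
  also have "\<dots> = (\<Sum>g\<in>supp \<gamma>. \<A> A * (\<gamma> g * (?c (gG1 g) - ?c (gG0 g))))"
  proof (rule sum.cong[OF refl])
    fix g assume "g \<in> supp \<gamma>"
    then have "gG1 g \<in> U" "gG0 g \<in> U" by (auto simp: U_def)
    then show "(\<Sum>G\<in>U. \<A> A * (\<gamma> g * ((if gG1 g = G then ?c G else 0) - (if gG0 g = G then ?c G else 0)))) =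
        \<A> A * (\<gamma> g * (?c (gG1 g) - ?c (gG0 g)))"
      unfolding sum_distrib_left[symmetric] sum_subtractf using finU by simp
  qed
  also have "\<dots> = \<A> A * (\<Sum>g\<in>supp \<gamma>. \<gamma> g * (?c (gG1 g) - ?c (gG0 g)))"
    by (rule sum_distrib_left[symmetric])
  finally show "(\<Sum>G\<in>supp (bd \<gamma>). \<A> A * bd \<gamma> G * ?c G) =
      \<A> A * (\<Sum>g\<in>supp \<gamma>. \<gamma> g * (?c (gG1 g) - ?c (gG0 g)))" .
qed

lemma pairG_d_lin:
  assumes "finite (supp \<A>)" "\<And>A. A \<in> supp \<A> \<Longrightarrow> finite A"
  shows "pairG (d_lin \<A>) \<gamma> = (\<Sum>A\<in>supp \<A>. \<A> A * (\<Sum>g\<in>supp \<gamma>. \<gamma> g *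
    (\<Sum>a\<in>supp (d_basis A). ip_germ (S_germ a) (I_germ g))))"
proof -
  let ?q = "\<lambda>a. \<Sum>g\<in>supp \<gamma>. \<gamma> g * ip_germ (S_germ a) (I_germ g)"
  \<comment> \<open>A finite index set that contains the supports for all \<open>A\<close> at once,
    so that the sums over \<open>A\<close> and over arrow germs can be interchanged.\<close>
  define U where "U = (\<Union>A\<in>supp \<A>. supp (d_basis A))"
  have finU: "finite U" unfolding U_def using assms finite_supp_d_basis by blast
  have "supp (d_lin \<A>) \<subseteq> U"
  proof
    fix a assume "a \<in> supp (d_lin \<A>)"
    then have "d_lin \<A> a \<noteq> 0" by (simp add: supp_def)
    then obtain A where "A \<in> supp \<A>" "\<A> A * d_basis A a \<noteq> 0"
      unfolding d_lin_def by (rule sum.not_neutral_contains_not_neutral)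
    then show "a \<in> U" unfolding U_def supp_def by auto
  qed
  have "pairG (d_lin \<A>) \<gamma> = (\<Sum>a\<in>supp (d_lin \<A>). d_lin \<A> a * ?q a)"
    unfolding pairG_def sum_distrib_left by (simp add: mult.assoc)
  also have "\<dots> = (\<Sum>a\<in>U. d_lin \<A> a * ?q a)"
    using finU \<open>supp (d_lin \<A>) \<subseteq> U\<close> by (intro sum.mono_neutral_left) (auto simp: supp_def)
  also have "\<dots> = (\<Sum>a\<in>U. \<Sum>A\<in>supp \<A>. \<A> A * (d_basis A a * ?q a))"
    unfolding d_lin_def sum_distrib_right by (simp add: mult.assoc)
  also have "\<dots> = (\<Sum>A\<in>supp \<A>. \<Sum>a\<in>U. \<A> A * (d_basis A a * ?q a))"
    by (rule sum.swap)
  also have "\<dots> = (\<Sum>A\<in>supp \<A>. \<A> A * (\<Sum>a\<in>supp (d_basis A). ?q a))"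
  proof (rule sum.cong[OF refl])
    fix A assume A: "A \<in> supp \<A>"
    have "(\<Sum>a\<in>U. d_basis A a * ?q a) = (\<Sum>a\<in>supp (d_basis A). d_basis A a * ?q a)"
      using finU A by (intro sum.mono_neutral_right) (auto simp: U_def supp_def)
    also have "\<dots> = (\<Sum>a\<in>supp (d_basis A). ?q a)"
    proof (rule sum.cong[OF refl])
      fix a assume "a \<in> supp (d_basis A)"
      then have "d_basis A a = 1" unfolding supp_def d_basis_def mem_Collect_eq by presburger
      then show "d_basis A a * ?q a = ?q a" by simp
    qed
    finally show "(\<Sum>a\<in>U. \<A> A * (d_basis A a * ?q a)) = \<A> A * (\<Sum>a\<in>supp (d_basis A). ?q a)"
      by (simp flip: sum_distrib_left)
  qed
  also have "\<dots> = (\<Sum>A\<in>supp \<A>. \<A> A * (\<Sum>g\<in>supp \<gamma>. \<gamma> g *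
      (\<Sum>a\<in>supp (d_basis A). ip_germ (S_germ a) (I_germ g))))"
    unfolding sum.swap[of _ "supp \<gamma>"] by (simp flip: sum_distrib_left)
  finally show ?thesis .
qed

theorem theorem1p4:
  fixes \<A> :: "arrowd \<Rightarrow> rat" and \<gamma> :: "bool germ \<Rightarrow> rat"
  assumes "finite (supp \<A>)" and "\<forall>A\<in>supp \<A>. wf_diag A"
    and "finite (supp \<gamma>)" and "\<forall>g\<in>supp \<gamma>. is_germ g"
  shows "pairG (d_lin \<A>) \<gamma> = pairD \<A> (bd \<gamma>)"
proof -
  have fin: "finite A" if "A \<in> supp \<A>" for A using assms(2) that wf_diag_finite by blast
  have "pairG (d_lin \<A>) \<gamma> = (\<Sum>A\<in>supp \<A>. \<A> A * (\<Sum>g\<in>supp \<gamma>. \<gamma> g *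
      (\<Sum>a\<in>supp (d_basis A). ip_germ (S_germ a) (I_germ g))))"
    by (rule pairG_d_lin[OF assms(1) fin])
  also have "\<dots> = pairD \<A> (bd \<gamma>)"
    unfolding pairD_bd[OF assms(3)] using assms(4) pairing_germ[OF _ fin] by simp
  finally show ?thesis .
qed

end
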